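(* Every $\lambda$-injective real Banach space is universally $(\lambda,4\lambda)$-left-stable.
   Context: All Banach spaces are real. A Banach space $X$ is $\lambda$-injective if every bounded linear operator $T$ from a closed subspace of a Banach space into $X$ can be extended to a bounded linear operator from the whole space into $X$ with norm at most $\lambda\|T\|$. Let $X,Y$ be Banach spaces and $\varepsilon\ge 0$. A mapping $f:X\to Y$ (not assumed linear or continuous) is an $\varepsilon$-isometry if $\bigl|\|f(x)-f(y)\|-\|x-y\|\bigr|\le\varepsilon$ for all $x,y\in X$; it is standard if $f(0)=0$. Let $L(f)=\overline{\mathrm{span}}\,f(X)\subset Y$. For real numbers $\alpha,\gamma>0$, a standard $\varepsilon$-isometry $f:X\to Y$ is $(\alpha,\gamma)$-stable if there is a bounded linear operator $T:L(f)\to X$ with $\|T\|\le\alpha$ and $\|Tf(x)-x\|\le\gamma\varepsilon$ for all $x\in X$. The pair $(X,Y)$ is $(\alpha,\gamma)$-stable if for every $\varepsilon\ge0$ every standard $\varepsilon$-isometry $f:X\to Y$ is $(\alpha,\gamma)$-stable. A Banach space $X$ is universally $(\alpha,\gamma)$-left-stable if the pair $(X,Y)$ is $(\alpha,\gamma)$-stable for every Banach space $Y$. *)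

theory Defs
  imports "HOL-Analysis.Analysis"
begin

text \<open>
  Being \<open>\<lambda>\<close>-injective is a hypothesis that itself quantifies over Banach spaces, and HOL cannot
  quantify over types inside a formula. The Banach spaces tested in that hypothesis are therefore
  presented with an explicit carrier set.
\<close>

record 'u normed_structure =
  points :: "'u set"
  origin :: 'u
  plus_of :: "'u \<Rightarrow> 'u \<Rightarrow> 'u"
  scale_of :: "real \<Rightarrow> 'u \<Rightarrow> 'u"
  norm_of :: "'u \<Rightarrow> real"

text \<open>The value \<open>0\<close> off the carrier makes this an instance of the locale \<^locale>\<open>Metric_space\<close>.\<close>

definition dist_of :: "'u normed_structure \<Rightarrow> 'u \<Rightarrow> 'u \<Rightarrow> real" where
  "dist_of Z x y =
     (if x \<in> points Z \<and> y \<in> points Z then norm_of Z (plus_of Z x (scale_of Z (- 1) y)) else 0)"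

definition is_vector_space :: "'u normed_structure \<Rightarrow> bool" where
  "is_vector_space Z \<longleftrightarrow>
     origin Z \<in> points Z \<and>
     (\<forall>x\<in>points Z. \<forall>y\<in>points Z. plus_of Z x y \<in> points Z) \<and>
     (\<forall>a. \<forall>x\<in>points Z. scale_of Z a x \<in> points Z) \<and>
     (\<forall>x\<in>points Z. \<forall>y\<in>points Z. \<forall>z\<in>points Z.
        plus_of Z (plus_of Z x y) z = plus_of Z x (plus_of Z y z)) \<and>
     (\<forall>x\<in>points Z. \<forall>y\<in>points Z. plus_of Z x y = plus_of Z y x) \<and>
     (\<forall>x\<in>points Z. plus_of Z (origin Z) x = x) \<and>
     (\<forall>x\<in>points Z. plus_of Z x (scale_of Z (- 1) x) = origin Z) \<and>
     (\<forall>a. \<forall>x\<in>points Z. \<forall>y\<in>points Z.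
        scale_of Z a (plus_of Z x y) = plus_of Z (scale_of Z a x) (scale_of Z a y)) \<and>
     (\<forall>a b. \<forall>x\<in>points Z. scale_of Z (a + b) x = plus_of Z (scale_of Z a x) (scale_of Z b x)) \<and>
     (\<forall>a b. \<forall>x\<in>points Z. scale_of Z a (scale_of Z b x) = scale_of Z (a * b) x) \<and>
     (\<forall>x\<in>points Z. scale_of Z 1 x = x)"

definition is_normed_space :: "'u normed_structure \<Rightarrow> bool" where
  "is_normed_space Z \<longleftrightarrow>
     is_vector_space Z \<and>
     (\<forall>x\<in>points Z. 0 \<le> norm_of Z x) \<and>
     (\<forall>x\<in>points Z. norm_of Z x = 0 \<longleftrightarrow> x = origin Z) \<and>
     (\<forall>x\<in>points Z. \<forall>y\<in>points Z. norm_of Z (plus_of Z x y) \<le> norm_of Z x + norm_of Z y) \<and>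
     (\<forall>a. \<forall>x\<in>points Z. norm_of Z (scale_of Z a x) = \<bar>a\<bar> * norm_of Z x)"

definition is_banach_space :: "'u normed_structure \<Rightarrow> bool" where
  "is_banach_space Z \<longleftrightarrow>
     is_normed_space Z \<and> Metric_space.mcomplete (points Z) (dist_of Z)"

definition is_subspace :: "'u normed_structure \<Rightarrow> 'u set \<Rightarrow> bool" where
  "is_subspace Z M \<longleftrightarrow>
     M \<subseteq> points Z \<and> origin Z \<in> M \<and>
     (\<forall>x\<in>M. \<forall>y\<in>M. plus_of Z x y \<in> M) \<and> (\<forall>a. \<forall>x\<in>M. scale_of Z a x \<in> M)"

definition is_closed_subspace :: "'u normed_structure \<Rightarrow> 'u set \<Rightarrow> bool" where
  "is_closed_subspace Z M \<longleftrightarrow>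
     is_subspace Z M \<and> closedin (Metric_space.mtopology (points Z) (dist_of Z)) M"

text \<open>Only the values of \<open>T\<close> on the subspace \<open>M\<close> matter in the next two definitions.\<close>

definition bounded_operator ::
    "'u normed_structure \<Rightarrow> 'u set \<Rightarrow> ('u \<Rightarrow> 'x::real_normed_vector) \<Rightarrow> bool" where
  "bounded_operator Z M T \<longleftrightarrow>
     (\<forall>x\<in>M. \<forall>y\<in>M. T (plus_of Z x y) = T x + T y) \<and>
     (\<forall>a. \<forall>x\<in>M. T (scale_of Z a x) = a *\<^sub>R T x) \<and>
     (\<exists>K. \<forall>x\<in>M. norm (T x) \<le> K * norm_of Z x)"

text \<open>As in \<^const>\<open>onorm\<close>, the quotient is \<open>0\<close> at the origin.\<close>

definition operator_norm ::
    "'u normed_structure \<Rightarrow> 'u set \<Rightarrow> ('u \<Rightarrow> 'x::real_normed_vector) \<Rightarrow> real" where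
  "operator_norm Z M T = (SUP x\<in>M. norm (T x) / norm_of Z x)"

definition injective_for :: "'u itself \<Rightarrow> 'x::banach itself \<Rightarrow> real \<Rightarrow> bool" where
  "injective_for U X lam \<longleftrightarrow>
     (\<forall>(Z :: 'u normed_structure) M (T :: 'u \<Rightarrow> 'x).
        is_banach_space Z \<and> is_closed_subspace Z M \<and> bounded_operator Z M T \<longrightarrow>
        (\<exists>S. bounded_operator Z (points Z) S \<and> (\<forall>x\<in>M. S x = T x) \<and>
             operator_norm Z (points Z) S \<le> lam * operator_norm Z M T))"

text \<open>
  The type of points is fixed so large that it contains the bounded functions on the dual
  ball of \<open>'x\<close>. Theorem \<open>injective_every_universe\<close> below shows that the extension property then
  holds for Banach spaces with points in an arbitrary type, so nothing is lost by the choice.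
\<close>

definition injective_space :: "'x::banach itself \<Rightarrow> real \<Rightarrow> bool" where
  "injective_space X lam \<longleftrightarrow> injective_for TYPE(('x \<Rightarrow> real) \<Rightarrow> real) X lam"

definition structure_of :: "'y::real_normed_vector itself \<Rightarrow> 'y normed_structure" where
  "structure_of Y =
     \<lparr>points = UNIV, origin = 0, plus_of = (+), scale_of = (*\<^sub>R), norm_of = norm\<rparr>"

definition eps_isometry :: "real \<Rightarrow> ('x::real_normed_vector \<Rightarrow> 'y::real_normed_vector) \<Rightarrow> bool" where
  "eps_isometry \<epsilon> f \<longleftrightarrow> (\<forall>x y. \<bar>norm (f x - f y) - norm (x - y)\<bar> \<le> \<epsilon>)"

definition standard_map :: "('x::real_normed_vector \<Rightarrow> 'y::real_normed_vector) \<Rightarrow> bool" where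
  "standard_map f \<longleftrightarrow> f 0 = 0"

definition L_space :: "('x::real_normed_vector \<Rightarrow> 'y::real_normed_vector) \<Rightarrow> 'y set" where
  "L_space f = closure (span (range f))"

text \<open>The operator lives on \<open>L_space f\<close> only; no extension to the whole of \<open>'y\<close> is asked for.\<close>

definition stable_map ::
    "real \<Rightarrow> real \<Rightarrow> real \<Rightarrow> ('x::real_normed_vector \<Rightarrow> 'y::real_normed_vector) \<Rightarrow> bool" where
  "stable_map \<alpha> \<gamma> \<epsilon> f \<longleftrightarrow>
     (\<exists>T :: 'y \<Rightarrow> 'x.
        bounded_operator (structure_of TYPE('y)) (L_space f) T \<and>
        operator_norm (structure_of TYPE('y)) (L_space f) T \<le> \<alpha> \<and>
        (\<forall>x. norm (T (f x) - x) \<le> \<gamma> * \<epsilon>))"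

text \<open>
  The space of \<open>'x\<close> is universally \<open>(\<alpha>, \<gamma>)\<close>-left-stable if \<open>stable_pair TYPE('x) TYPE('y) \<alpha> \<gamma>\<close>
  holds with the type variable \<open>'y\<close> of class \<open>banach\<close> left schematic: the quantification over all
  target spaces is the one over \<open>'y\<close>.
\<close>

definition stable_pair :: "'x::banach itself \<Rightarrow> 'y::banach itself \<Rightarrow> real \<Rightarrow> real \<Rightarrow> bool" where
  "stable_pair X Y \<alpha> \<gamma> \<longleftrightarrow>
     (\<forall>\<epsilon>\<ge>0. \<forall>f :: 'x \<Rightarrow> 'y. eps_isometry \<epsilon> f \<and> standard_map f \<longrightarrow> stable_map \<alpha> \<gamma> \<epsilon> f)"

text \<open>
  The rest of the theory justifies the choice of universe in \<open>injective_space\<close>: a bounded operator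
  into \<open>'x\<close> is extended by composing with the canonical embedding of \<open>'x\<close> into the bounded functions
  on the dual ball, applying the Hahn--Banach theorem coordinatewise, and returning to \<open>'x\<close> with
  the extension of the inverse of the embedding.
\<close>

context
  fixes Z :: "'u normed_structure"
  assumes V: "is_vector_space Z"
begin

lemma vs_closed [simp]:
  "origin Z \<in> points Z"
  "x \<in> points Z \<Longrightarrow> y \<in> points Z \<Longrightarrow> plus_of Z x y \<in> points Z"
  "x \<in> points Z \<Longrightarrow> scale_of Z a x \<in> points Z"
  using V by (auto simp: is_vector_space_def)

lemma vs_laws:
  "x \<in> points Z \<Longrightarrow> y \<in> points Z \<Longrightarrow> z \<in> points Z \<Longrightarrow>
     plus_of Z (plus_of Z x y) z = plus_of Z x (plus_of Z y z)"
  "x \<in> points Z \<Longrightarrow> y \<in> points Z \<Longrightarrow> plus_of Z x y = plus_of Z y x"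
  "x \<in> points Z \<Longrightarrow> plus_of Z (origin Z) x = x"
  "x \<in> points Z \<Longrightarrow> plus_of Z x (scale_of Z (- 1) x) = origin Z"
  "x \<in> points Z \<Longrightarrow> y \<in> points Z \<Longrightarrow>
     scale_of Z a (plus_of Z x y) = plus_of Z (scale_of Z a x) (scale_of Z a y)"
  "x \<in> points Z \<Longrightarrow> scale_of Z (a + b) x = plus_of Z (scale_of Z a x) (scale_of Z b x)"
  "x \<in> points Z \<Longrightarrow> scale_of Z a (scale_of Z b x) = scale_of Z (a * b) x"
  "x \<in> points Z \<Longrightarrow> scale_of Z 1 x = x"
  using V unfolding is_vector_space_def by meson+

lemma vs_left_commute:
  "x \<in> points Z \<Longrightarrow> y \<in> points Z \<Longrightarrow> z \<in> points Z \<Longrightarrow>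
     plus_of Z x (plus_of Z y z) = plus_of Z y (plus_of Z x z)"
  by (metis vs_laws(1,2))

lemmas vs_ac = vs_laws(1,2) vs_left_commute

lemma vs_right_neutral: "x \<in> points Z \<Longrightarrow> plus_of Z x (origin Z) = x"
  by (metis vs_laws(2,3) vs_closed(1))

lemma vs_left_inverse: "x \<in> points Z \<Longrightarrow> plus_of Z (scale_of Z (- 1) x) x = origin Z"
  by (simp add: vs_laws(2,4))

lemma scale_zero: "x \<in> points Z \<Longrightarrow> scale_of Z 0 x = origin Z"
  using vs_laws(6)[of x 1 "- 1"] vs_laws(4,8) by simp

lemma scale_origin: "scale_of Z a (origin Z) = origin Z"
  using vs_laws(7)[of "origin Z" a 0] scale_zero[of "origin Z"] by simp

lemma vs_cancel: "x \<in> points Z \<Longrightarrow> y \<in> points Z \<Longrightarrow>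
    plus_of Z (plus_of Z x y) (scale_of Z (- 1) y) = x"
  by (simp add: vs_laws(1,4) vs_right_neutral)

definition sublin :: "('u \<Rightarrow> real) \<Rightarrow> bool" where
  "sublin p \<longleftrightarrow>
     (\<forall>x\<in>points Z. \<forall>y\<in>points Z. p (plus_of Z x y) \<le> p x + p y) \<and>
     (\<forall>a>0. \<forall>x\<in>points Z. p (scale_of Z a x) \<le> a * p x) \<and>
     p (origin Z) \<le> 0 \<and> (\<forall>x. x \<notin> points Z \<longrightarrow> p x = 0)"

lemma sublinD:
  assumes "sublin p"
  shows "x \<in> points Z \<Longrightarrow> y \<in> points Z \<Longrightarrow> p (plus_of Z x y) \<le> p x + p y"
    and "p (origin Z) = 0"
    and "a \<ge> 0 \<Longrightarrow> x \<in> points Z \<Longrightarrow> p (scale_of Z a x) = a * p x"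
    and "x \<notin> points Z \<Longrightarrow> p x = 0"
    and "x \<in> points Z \<Longrightarrow> - p (scale_of Z (- 1) x) \<le> p x"
proof -
  note * = assms[unfolded sublin_def]
  show 1: "p (plus_of Z x y) \<le> p x + p y" if "x \<in> points Z" "y \<in> points Z" for x y
    using * that by blast
  show 2: "p (origin Z) = 0"
    using 1[of "origin Z" "origin Z"] * by (simp add: vs_laws(3))
  show "p (scale_of Z a x) = a * p x" if "a \<ge> 0" "x \<in> points Z" for a
  proof (cases "a = 0")
    case True
    then show ?thesis using that 2 by (simp add: scale_zero)
  next
    case False
    then have a: "a > 0" using that by simp
    have "p (scale_of Z (1/a) (scale_of Z a x)) \<le> (1/a) * p (scale_of Z a x)"
      using * a that by (meson vs_closed(3) zero_less_divide_1_iff)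
    then have "p x \<le> (1/a) * p (scale_of Z a x)"
      using a that by (simp add: vs_laws(7,8))
    then have "a * p x \<le> p (scale_of Z a x)"
      using a by (simp add: field_simps)
    moreover have "p (scale_of Z a x) \<le> a * p x" using * a that by blast
    ultimately show ?thesis by simp
  qed
  show "x \<notin> points Z \<Longrightarrow> p x = 0" using * by blast
  show "- p (scale_of Z (- 1) x) \<le> p x" if "x \<in> points Z"
    using 1[of x "scale_of Z (- 1) x"] 2 that by (simp add: vs_laws(4))
qed

lemma sublin_INF:
  assumes ne: "I \<noteq> {}"
    and bdd: "\<And>x. x \<in> points Z \<Longrightarrow> bdd_below ((\<lambda>i. h i x) ` I)"
    and add: "\<And>i j x y. i \<in> I \<Longrightarrow> j \<in> I \<Longrightarrow> x \<in> points Z \<Longrightarrow> y \<in> points Z \<Longrightarrow>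
                \<exists>k\<in>I. h k (plus_of Z x y) \<le> h i x + h j y"
    and sc: "\<And>i a x. i \<in> I \<Longrightarrow> a > 0 \<Longrightarrow> x \<in> points Z \<Longrightarrow> \<exists>k\<in>I. h k (scale_of Z a x) \<le> a * h i x"
    and z: "\<exists>k\<in>I. h k (origin Z) \<le> 0"
  shows "sublin (\<lambda>x. if x \<in> points Z then INF i\<in>I. (h i x :: real) else 0)"
proof -
  define u where "u = (\<lambda>x. INF i\<in>I. h i x)"
  have lo: "u x \<le> h i x" if "i \<in> I" "x \<in> points Z" for i x
    unfolding u_def by (rule cINF_lower[OF bdd[OF that(2)] that(1)])
  have gr: "c \<le> u x" if "\<And>i. i \<in> I \<Longrightarrow> c \<le> h i x" for c x
    unfolding u_def by (rule cINF_greatest[OF ne that])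
  have "u (plus_of Z x y) \<le> u x + u y" if xy: "x \<in> points Z" "y \<in> points Z" for x y
  proof -
    have "u (plus_of Z x y) - h i x \<le> u y" if "i \<in> I" for i
    proof (rule gr)
      fix j assume "j \<in> I"
      then obtain k where "k \<in> I" "h k (plus_of Z x y) \<le> h i x + h j y"
        using add \<open>i \<in> I\<close> xy by blast
      then show "u (plus_of Z x y) - h i x \<le> h j y"
        using lo[of k "plus_of Z x y"] xy by simp
    qed
    then have "u (plus_of Z x y) - u y \<le> u x"
      by (intro gr) (simp add: algebra_simps)
    then show ?thesis by simp
  qed
  moreover have "u (scale_of Z a x) \<le> a * u x" if ax: "a > 0" "x \<in> points Z" for a x
  proof -
    have "u (scale_of Z a x) / a \<le> u x"
    proof (rule gr)
      fix i assume "i \<in> I"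
      then obtain k where "k \<in> I" "h k (scale_of Z a x) \<le> a * h i x"
        using sc ax by blast
      then show "u (scale_of Z a x) / a \<le> h i x"
        using lo[of k "scale_of Z a x"] ax by (simp add: field_simps)
    qed
    then show ?thesis using ax by (simp add: field_simps)
  qed
  moreover have "u (origin Z) \<le> 0" using z lo by (meson order_trans vs_closed(1))
  ultimately show ?thesis unfolding sublin_def u_def by simp
qed

lemma minimal_sublin:
  assumes p: "sublin p"
  shows "\<exists>g. sublin g \<and> g \<le> p \<and> (\<forall>q. sublin q \<longrightarrow> q \<le> g \<longrightarrow> q = g)"
proof -
  define A where "A = {q. sublin q \<and> q \<le> p}"
  have "\<exists>m\<in>A. \<forall>a\<in>A. a \<le> m \<longrightarrow> a = m"
  proof (rule predicate_Zorn[of A "\<lambda>q r. r \<le> q"])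
    show "partial_order_on A (relation_of (\<lambda>q r. r \<le> q) A)"
      by (rule partial_order_on_relation_ofI) auto
  next
    fix C assume C: "C \<in> Chains (relation_of (\<lambda>q r. r \<le> q) A)"
    have CA: "C \<subseteq> A" using C unfolding Chains_def relation_of_def by blast
    have tot: "q \<le> r \<or> r \<le> q" if "q \<in> C" "r \<in> C" for q r
      using C that unfolding Chains_def relation_of_def by blast
    show "\<exists>u\<in>A. \<forall>a\<in>C. u \<le> a"
    proof (cases "C = {}")
      case True
      then show ?thesis using p by (auto simp: A_def)
    next
      case False
      define u where "u = (\<lambda>x. if x \<in> points Z then INF q\<in>C. q x else 0)"
      have sC: "sublin q" "q \<le> p" if "q \<in> C" for q using CA that by (auto simp: A_def)
      have bdd: "bdd_below ((\<lambda>q. q x) ` C)" if "x \<in> points Z" for x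
      proof (rule bdd_belowI2)
        fix q assume q: "q \<in> C"
        have "- p (scale_of Z (- 1) x) \<le> - q (scale_of Z (- 1) x)"
          using sC(2)[OF q] by (simp add: le_fun_def)
        then show "- p (scale_of Z (- 1) x) \<le> q x"
          using sublinD(5)[OF sC(1)[OF q] that] by linarith
      qed
      have su: "sublin u" unfolding u_def
      proof (rule sublin_INF[where h="\<lambda>q x. q x"])
        fix q r x y assume a: "q \<in> C" "r \<in> C" "x \<in> points Z" "y \<in> points Z"
        show "\<exists>k\<in>C. k (plus_of Z x y) \<le> q x + r y"
        proof (cases "q \<le> r")
          case True
          then show ?thesis using a sublinD(1)[OF sC(1), of q x y]
            by (intro bexI[of _ q]) (auto simp: le_fun_def dest: spec[of _ y])
        next
          case False
          then have "r \<le> q" using tot a by blast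
          then show ?thesis using a sublinD(1)[OF sC(1), of r x y]
            by (intro bexI[of _ r]) (auto simp: le_fun_def dest: spec[of _ x])
        qed
      next
        fix q x and a :: real assume "q \<in> C" "a > 0" "x \<in> points Z"
        then show "\<exists>k\<in>C. k (scale_of Z a x) \<le> a * q x"
          using sublinD(3)[OF sC(1), of q a x] by (intro bexI[of _ q]) auto
      next
        show "\<exists>k\<in>C. k (origin Z) \<le> 0" using False sublinD(2)[OF sC(1)] by fastforce
      qed (use False bdd in auto)
      have ub: "u \<le> q" if "q \<in> C" for q
        using bdd sublinD(4)[OF sC(1)[OF that]] that
        by (auto simp: le_fun_def u_def intro!: cINF_lower)
      moreover have "u \<le> p" using False ub sC(2) by (meson all_not_in_conv order_trans)
      ultimately show ?thesis using su by (auto simp: A_def)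
    qed
  qed
  then obtain m where "m \<in> A" and "\<And>a. a \<in> A \<Longrightarrow> a \<le> m \<Longrightarrow> a = m" by blast
  then show ?thesis by (intro exI[of _ m]) (auto simp: A_def intro: order_trans)
qed

lemma hahn_banach_sublin:
  assumes p: "sublin p"
  shows "\<exists>g. (\<forall>x\<in>points Z. \<forall>y\<in>points Z. g (plus_of Z x y) = g x + g y) \<and>
             (\<forall>a. \<forall>x\<in>points Z. g (scale_of Z a x) = a * g x) \<and> (\<forall>x\<in>points Z. g x \<le> p x)"
proof -
  obtain g where g: "sublin g" "g \<le> p" and min: "\<And>q. sublin q \<Longrightarrow> q \<le> g \<Longrightarrow> q = g"
    using minimal_sublin[OF p] by blast
  have add: "g (plus_of Z x y) = g x + g y" if xy: "x \<in> points Z" "y \<in> points Z" for x y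
  proof -
    define h where "h = (\<lambda>t x. g (plus_of Z x (scale_of Z t y)) - t * g y)"
    define q where "q = (\<lambda>x. if x \<in> points Z then INF t\<in>{0..}. h t x else 0)"
    have bdd: "bdd_below ((\<lambda>t. h t x) ` {0..})" if x: "x \<in> points Z" for x
    proof (rule bdd_belowI2)
      fix t :: real assume "t \<in> {0..}"
      then have "t * g y = g (scale_of Z t y)"
        using sublinD(3)[OF g(1), of t y] xy by simp
      also have "scale_of Z t y =
          plus_of Z (plus_of Z x (scale_of Z t y)) (scale_of Z (- 1) x)"
        using x xy vs_cancel[of "scale_of Z t y" x] by (simp add: vs_laws(2))
      also have "g \<dots> \<le> g (plus_of Z x (scale_of Z t y)) + g (scale_of Z (- 1) x)"
        using x xy by (intro sublinD(1)[OF g(1)]) auto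
      finally show "- g (scale_of Z (- 1) x) \<le> h t x" by (simp add: h_def)
    qed
    have "sublin q" unfolding q_def
    proof (rule sublin_INF)
      fix s t :: real and x x' assume a: "s \<in> {0..}" "t \<in> {0..}" "x \<in> points Z" "x' \<in> points Z"
      have "plus_of Z (plus_of Z x x') (scale_of Z (s + t) y) =
            plus_of Z (plus_of Z x (scale_of Z s y)) (plus_of Z x' (scale_of Z t y))"
        using a xy by (simp add: vs_laws(6) vs_ac)
      then have "h (s + t) (plus_of Z x x') \<le> h s x + h t x'"
        using sublinD(1)[OF g(1), of "plus_of Z x (scale_of Z s y)" "plus_of Z x' (scale_of Z t y)"] a xy
        by (simp add: h_def algebra_simps)
      then show "\<exists>k\<in>{0..}. h k (plus_of Z x x') \<le> h s x + h t x'"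
        using a by (intro bexI[of _ "s + t"]) auto
    next
      fix t a :: real and x assume a: "t \<in> {0..}" "0 < a" "x \<in> points Z"
      have "plus_of Z (scale_of Z a x) (scale_of Z (a * t) y) =
            scale_of Z a (plus_of Z x (scale_of Z t y))"
        using a xy by (simp add: vs_laws(5,7))
      then have "h (a * t) (scale_of Z a x) \<le> a * h t x"
        using sublinD(3)[OF g(1), of a "plus_of Z x (scale_of Z t y)"] a xy
        by (simp add: h_def algebra_simps)
      then show "\<exists>k\<in>{0..}. h k (scale_of Z a x) \<le> a * h t x"
        using a by (intro bexI[of _ "a * t"]) auto
    next
      show "\<exists>k\<in>{0::real..}. h k (origin Z) \<le> 0"
        using xy sublinD(2)[OF g(1)]
        by (intro bexI[of _ 0]) (auto simp: h_def scale_zero vs_laws(3))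
    qed (use bdd in auto)
    moreover have qh: "q x \<le> h t x" if "x \<in> points Z" "t \<ge> 0" for x t
      unfolding q_def using that bdd[of x] by (auto intro!: cINF_lower)
    have "q \<le> g"
    proof (rule le_funI)
      fix x
      show "q x \<le> g x"
      proof (cases "x \<in> points Z")
        case True
        then show ?thesis using qh[of x 0] xy by (simp add: h_def scale_zero vs_right_neutral)
      next
        case False
        then show ?thesis using sublinD(4)[OF g(1)] by (simp add: q_def)
      qed
    qed
    ultimately have "q = g" using min by blast
    then have "g x \<le> g (plus_of Z x y) - g y"
      using qh[of x 1] xy by (simp add: h_def vs_laws(8))
    then show ?thesis using sublinD(1)[OF g(1), of x y] xy by simp
  qed
  have neg: "g (scale_of Z (- 1) x) = - g x" if "x \<in> points Z" for x
    using add[of x "scale_of Z (- 1) x"] that sublinD(2)[OF g(1)] by (simp add: vs_laws(4))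
  have "g (scale_of Z a x) = a * g x" if "x \<in> points Z" for a x
  proof (cases "a \<ge> 0")
    case True
    then show ?thesis using sublinD(3)[OF g(1)] that by blast
  next
    case False
    then have "g (scale_of Z (- a) x) = - a * g x" using sublinD(3)[OF g(1), of "- a" x] that by simp
    moreover have "scale_of Z (- 1) (scale_of Z (- a) x) = scale_of Z a x"
      using that by (simp add: vs_laws(7))
    ultimately show ?thesis using neg[of "scale_of Z (- a) x"] that by simp
  qed
  then show ?thesis using add g(2) unfolding le_fun_def by blast
qed

end

lemma hahn_banach_norm:
  fixes Z :: "'u normed_structure"
  assumes Z: "is_normed_space Z" and M: "is_subspace Z M" and K: "K \<ge> 0"
    and add: "\<And>x y. x \<in> M \<Longrightarrow> y \<in> M \<Longrightarrow> \<phi> (plus_of Z x y) = \<phi> x + \<phi> y"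
    and sc: "\<And>a x. x \<in> M \<Longrightarrow> \<phi> (scale_of Z a x) = a * \<phi> x"
    and bd: "\<And>x. x \<in> M \<Longrightarrow> \<bar>\<phi> x\<bar> \<le> K * norm_of Z x"
  shows "\<exists>g. (\<forall>x\<in>points Z. \<forall>y\<in>points Z. g (plus_of Z x y) = g x + g y) \<and>
             (\<forall>a. \<forall>x\<in>points Z. g (scale_of Z a x) = a * g x) \<and>
             (\<forall>x\<in>M. g x = \<phi> x) \<and> (\<forall>x\<in>points Z. \<bar>g x\<bar> \<le> K * norm_of Z x)"
proof -
  have V: "is_vector_space Z" using Z by (simp add: is_normed_space_def)
  note cl [simp] = vs_closed[OF V]
  note laws = vs_laws[OF V]
  have tri: "norm_of Z (plus_of Z x y) \<le> norm_of Z x + norm_of Z y"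
    if "x \<in> points Z" "y \<in> points Z" for x y using Z that by (simp add: is_normed_space_def)
  have hom: "norm_of Z (scale_of Z a x) = \<bar>a\<bar> * norm_of Z x" if "x \<in> points Z" for a x
    using Z that by (simp add: is_normed_space_def)
  have M0: "origin Z \<in> M" and MP: "\<And>x. x \<in> M \<Longrightarrow> x \<in> points Z"
    and Ma: "\<And>x y. x \<in> M \<Longrightarrow> y \<in> M \<Longrightarrow> plus_of Z x y \<in> M"
    and Ms: "\<And>a x. x \<in> M \<Longrightarrow> scale_of Z a x \<in> M"
    using M by (auto simp: is_subspace_def)
  define h where "h = (\<lambda>m z. \<phi> m + K * norm_of Z (plus_of Z z (scale_of Z (- 1) m)))"
  define p where "p = (\<lambda>z. if z \<in> points Z then INF m\<in>M. h m z else 0)"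
  have bdd: "bdd_below ((\<lambda>m. h m z) ` M)" if z: "z \<in> points Z" for z
  proof (rule bdd_belowI2)
    fix m assume m: "m \<in> M"
    have "norm_of Z (scale_of Z (- 1) m) =
        norm_of Z (plus_of Z (plus_of Z z (scale_of Z (- 1) m)) (scale_of Z (- 1) z))"
      using z MP[OF m] vs_cancel[OF V, of "scale_of Z (- 1) m" z] by (simp add: laws(2))
    also have "\<dots> \<le> norm_of Z (plus_of Z z (scale_of Z (- 1) m)) + norm_of Z (scale_of Z (- 1) z)"
      using z MP[OF m] by (intro tri) auto
    finally have "norm_of Z m \<le> norm_of Z (plus_of Z z (scale_of Z (- 1) m)) + norm_of Z z"
      using z MP[OF m] by (simp add: hom)
    then have "K * norm_of Z m \<le> K * (norm_of Z (plus_of Z z (scale_of Z (- 1) m)) + norm_of Z z)"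
      using K by (rule mult_left_mono)
    then show "- (K * norm_of Z z) \<le> h m z"
      using bd[OF m] by (simp add: h_def algebra_simps)
  qed
  have "sublin Z p" unfolding p_def
  proof (rule sublin_INF[OF V])
    fix m n z w assume a: "m \<in> M" "n \<in> M" "z \<in> points Z" "w \<in> points Z"
    have "plus_of Z (plus_of Z z w) (scale_of Z (- 1) (plus_of Z m n)) =
          plus_of Z (plus_of Z z (scale_of Z (- 1) m)) (plus_of Z w (scale_of Z (- 1) n))"
      using a MP by (simp add: laws(5) vs_ac[OF V])
    then have "norm_of Z (plus_of Z (plus_of Z z w) (scale_of Z (- 1) (plus_of Z m n))) \<le>
       norm_of Z (plus_of Z z (scale_of Z (- 1) m)) + norm_of Z (plus_of Z w (scale_of Z (- 1) n))"
      using a MP tri by simp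
    then have "K * norm_of Z (plus_of Z (plus_of Z z w) (scale_of Z (- 1) (plus_of Z m n))) \<le>
       K * (norm_of Z (plus_of Z z (scale_of Z (- 1) m)) + norm_of Z (plus_of Z w (scale_of Z (- 1) n)))"
      using K by (rule mult_left_mono)
    then have "h (plus_of Z m n) (plus_of Z z w) \<le> h m z + h n w"
      using a add by (simp add: h_def algebra_simps)
    then show "\<exists>k\<in>M. h k (plus_of Z z w) \<le> h m z + h n w" using a Ma by blast
  next
    fix m a z assume a: "m \<in> M" "(0::real) < a" "z \<in> points Z"
    have "plus_of Z (scale_of Z a z) (scale_of Z (- 1) (scale_of Z a m)) =
          scale_of Z a (plus_of Z z (scale_of Z (- 1) m))"
      using a MP by (simp add: laws(5,7))
    then have "h (scale_of Z a m) (scale_of Z a z) \<le> a * h m z"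
      using a MP sc by (simp add: h_def hom algebra_simps)
    then show "\<exists>k\<in>M. h k (scale_of Z a z) \<le> a * h m z" using a Ms by blast
  next
    have "\<phi> (origin Z) = 0" using sc[OF M0, of 0] by (simp add: scale_zero[OF V])
    then have "h (origin Z) (origin Z) \<le> 0"
      using hom[of "origin Z" 0] by (simp add: h_def laws(4) scale_zero[OF V])
    then show "\<exists>k\<in>M. h k (origin Z) \<le> 0" using M0 by blast
  qed (use M0 bdd in auto)
  from hahn_banach_sublin[OF V this] obtain g where
    ga: "\<And>x y. x \<in> points Z \<Longrightarrow> y \<in> points Z \<Longrightarrow> g (plus_of Z x y) = g x + g y" and
    gs: "\<And>a x. x \<in> points Z \<Longrightarrow> g (scale_of Z a x) = a * g x" and
    gp: "\<And>x. x \<in> points Z \<Longrightarrow> g x \<le> p x" by blast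
  have ph: "p z \<le> h m z" if "z \<in> points Z" "m \<in> M" for z m
    using that bdd by (auto simp: p_def intro!: cINF_lower)
  have le: "g z \<le> K * norm_of Z z" if z: "z \<in> points Z" for z
  proof -
    have "\<phi> (origin Z) = 0" using sc[OF M0, of 0] by (simp add: scale_zero[OF V])
    then show ?thesis
      using gp[OF z] ph[OF z M0] z
      by (simp add: h_def scale_origin[OF V] vs_right_neutral[OF V])
  qed
  have lm: "g m \<le> \<phi> m" if m: "m \<in> M" for m
    using gp[OF MP[OF m]] ph[OF MP[OF m] m] hom[of "origin Z" 0]
    by (simp add: h_def laws(4)[OF MP[OF m]] scale_zero[OF V])
  have "g m = \<phi> m" if m: "m \<in> M" for m
    using lm[OF m] lm[OF Ms[OF m, of "- 1"]] gs[OF MP[OF m], of "- 1"] sc[OF m, of "- 1"] by simp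
  moreover have "\<bar>g z\<bar> \<le> K * norm_of Z z" if z: "z \<in> points Z" for z
    using le[OF z] le[of "scale_of Z (- 1) z"] gs[OF z, of "- 1"] hom[OF z, of "- 1"] z by simp
  ultimately show ?thesis using ga gs by blast
qed

lemma normed_space_laws:
  assumes "is_normed_space Z"
  shows "is_vector_space Z"
    and "x \<in> points Z \<Longrightarrow> 0 \<le> norm_of Z x"
    and "x \<in> points Z \<Longrightarrow> norm_of Z x = 0 \<longleftrightarrow> x = origin Z"
    and "x \<in> points Z \<Longrightarrow> y \<in> points Z \<Longrightarrow> norm_of Z (plus_of Z x y) \<le> norm_of Z x + norm_of Z y"
    and "x \<in> points Z \<Longrightarrow> norm_of Z (scale_of Z a x) = \<bar>a\<bar> * norm_of Z x"
  using assms unfolding is_normed_space_def by blast+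

lemma metric_space_dist_of:
  assumes Z: "is_normed_space Z"
  shows "Metric_space (points Z) (dist_of Z)"
proof -
  note V = normed_space_laws(1)[OF Z]
  note [simp] = vs_closed[OF V]
  note laws = vs_laws[OF V]
  let ?m = "\<lambda>x y. plus_of Z x (scale_of Z (- 1) y)"
  have sw: "?m y x = scale_of Z (- 1) (?m x y)" if "x \<in> points Z" "y \<in> points Z" for x y
    using that by (simp add: laws(5,7,8) laws(2)[of "scale_of Z (- 1) x"])
  have add: "?m x z = plus_of Z (?m x y) (?m y z)"
    if "x \<in> points Z" "y \<in> points Z" "z \<in> points Z" for x y z
  proof -
    have "plus_of Z (scale_of Z (- 1) y) (?m y z) = scale_of Z (- 1) z"
      using that by (simp add: laws(1)[symmetric] vs_left_inverse[OF V] laws(3))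
    then show ?thesis using that by (simp add: laws(1))
  qed
  have z: "x = y" if "x \<in> points Z" "y \<in> points Z" "?m x y = origin Z" for x y
  proof -
    have "plus_of Z (?m x y) y = x"
      using that(1,2) by (simp add: laws(1) vs_left_inverse[OF V] vs_right_neutral[OF V])
    then show ?thesis using that laws(3) by simp
  qed
  show ?thesis
  proof
    show "0 \<le> dist_of Z x y" for x y
      by (simp add: dist_of_def normed_space_laws(2)[OF Z])
    show "dist_of Z x y = dist_of Z y x" for x y
      by (auto simp: dist_of_def sw[of x y] normed_space_laws(5)[OF Z])
    show "dist_of Z x y = 0 \<longleftrightarrow> x = y" if "x \<in> points Z" "y \<in> points Z" for x y
      using that z[of x y] by (auto simp: dist_of_def normed_space_laws(3)[OF Z] laws(4))
    show "dist_of Z x z \<le> dist_of Z x y + dist_of Z y z"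
      if "x \<in> points Z" "y \<in> points Z" "z \<in> points Z" for x y z
      using that normed_space_laws(4)[OF Z, of "?m x y" "?m y z"] add[of x y z]
      by (simp add: dist_of_def)
  qed
qed

lemma structure_of_simps [simp]:
  "points (structure_of Y) = UNIV" "origin (structure_of Y) = 0"
  "plus_of (structure_of Y) = (+)" "scale_of (structure_of Y) = (*\<^sub>R)"
  "norm_of (structure_of Y) = norm"
  by (simp_all add: structure_of_def)

lemma dist_of_structure_of [simp]: "dist_of (structure_of Y) = dist"
  by (intro ext) (simp add: dist_of_def dist_norm)

lemma normed_structure_of: "is_normed_space (structure_of Y)"
  unfolding is_normed_space_def is_vector_space_def
  by (auto simp: algebra_simps norm_triangle_ineq)

lemma banach_structure_of: "is_banach_space (structure_of TYPE('y::banach))"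
proof -
  have "Met_TC.mcomplete (TYPE('y))"
    by (simp add: complete_UNIV)
  then show ?thesis by (simp add: is_banach_space_def normed_structure_of)
qed

lemma closed_subspace_L_space: "is_closed_subspace (structure_of TYPE('y::banach)) (L_space f)"
proof -
  let ?S = "span (range f)"
  have "x + y \<in> closure ?S" if xy: "x \<in> closure ?S" "y \<in> closure ?S" for x y
  proof -
    obtain u v where "\<And>n. u n \<in> ?S" "u \<longlonglongrightarrow> x" "\<And>n. v n \<in> ?S" "v \<longlonglongrightarrow> y"
      using xy unfolding closure_sequential by blast
    then show ?thesis
      unfolding closure_sequential
      by (intro exI[of _ "\<lambda>n. u n + v n"]) (auto intro: span_add tendsto_add)
  qed
  moreover have "a *\<^sub>R x \<in> closure ?S" if x: "x \<in> closure ?S" for a x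
  proof -
    obtain u where "\<And>n. u n \<in> ?S" "u \<longlonglongrightarrow> x"
      using x unfolding closure_sequential by blast
    then show ?thesis
      unfolding closure_sequential
      by (intro exI[of _ "\<lambda>n. a *\<^sub>R u n"]) (auto intro: span_scale tendsto_intros)
  qed
  moreover have "0 \<in> closure ?S" using closure_subset span_zero by blast
  ultimately show ?thesis by (simp add: is_closed_subspace_def is_subspace_def L_space_def)
qed

lemma bounded_operatorD:
  assumes Z: "is_normed_space Z" and M: "is_subspace Z M" and T: "bounded_operator Z M T"
  shows "0 \<le> operator_norm Z M T"
    and "x \<in> M \<Longrightarrow> norm (T x) \<le> operator_norm Z M T * norm_of Z x"
proof -
  obtain K where K: "\<And>x. x \<in> M \<Longrightarrow> norm (T x) \<le> K * norm_of Z x"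
    using T unfolding bounded_operator_def by blast
  have MP: "M \<subseteq> points Z" and M0: "origin Z \<in> M" using M by (auto simp: is_subspace_def)
  have nn: "0 \<le> norm_of Z x" if "x \<in> M" for x using normed_space_laws(2)[OF Z] MP that by blast
  have bdd: "bdd_above ((\<lambda>x. norm (T x) / norm_of Z x) ` M)"
  proof (rule bdd_aboveI2)
    fix x assume x: "x \<in> M"
    show "norm (T x) / norm_of Z x \<le> \<bar>K\<bar>"
    proof (cases "norm_of Z x = 0")
      case False
      then have "norm_of Z x > 0" using nn[OF x] by simp
      moreover have "norm (T x) \<le> \<bar>K\<bar> * norm_of Z x"
        using K[OF x] nn[OF x] by (meson abs_ge_self mult_right_mono order_trans)
      ultimately show ?thesis by (simp add: field_simps)
    qed auto
  qed
  have up: "norm (T x) / norm_of Z x \<le> operator_norm Z M T" if "x \<in> M" for x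
    unfolding operator_norm_def by (rule cSUP_upper[OF that bdd])
  have "norm (T (origin Z)) / norm_of Z (origin Z) = 0"
    using normed_space_laws(3)[OF Z, of "origin Z"] M0 MP by auto
  then show "0 \<le> operator_norm Z M T" using up[OF M0] by linarith
  show "norm (T x) \<le> operator_norm Z M T * norm_of Z x" if x: "x \<in> M"
  proof (cases "norm_of Z x = 0")
    case True
    then show ?thesis using K[OF x] by simp
  next
    case False
    then show ?thesis using up[OF x] nn[OF x] by (simp add: field_simps)
  qed
qed

lemma operator_norm_le:
  assumes Z: "is_normed_space Z" and M: "is_subspace Z M" and c: "0 \<le> c"
    and b: "\<And>x. x \<in> M \<Longrightarrow> norm (T x) \<le> c * norm_of Z x"
  shows "operator_norm Z M T \<le> c"
  unfolding operator_norm_def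
proof (rule cSUP_least)
  show "M \<noteq> {}" using M by (auto simp: is_subspace_def)
  fix x assume x: "x \<in> M"
  have "0 \<le> norm_of Z x" using normed_space_laws(2)[OF Z] M x by (auto simp: is_subspace_def)
  then show "norm (T x) / norm_of Z x \<le> c"
    using b[OF x] c by (cases "norm_of Z x = 0") (auto simp: field_simps)
qed

definition linf :: "'i set \<Rightarrow> ('i \<Rightarrow> real) normed_structure" where
  "linf B = \<lparr>points = {w. (\<exists>K. \<forall>i\<in>B. \<bar>w i\<bar> \<le> K) \<and> (\<forall>i. i \<notin> B \<longrightarrow> w i = 0)},
     origin = (\<lambda>i. 0), plus_of = (\<lambda>v w i. v i + w i), scale_of = (\<lambda>a w i. a * w i),
     norm_of = (\<lambda>w. SUP i\<in>B. \<bar>w i\<bar>)\<rparr>"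

lemma linf_simps [simp]:
  "w \<in> points (linf B) \<longleftrightarrow> (\<exists>K. \<forall>i\<in>B. \<bar>w i\<bar> \<le> K) \<and> (\<forall>i. i \<notin> B \<longrightarrow> w i = 0)"
  "origin (linf B) = (\<lambda>i. 0)" "plus_of (linf B) = (\<lambda>v w i. v i + w i)"
  "scale_of (linf B) = (\<lambda>a w i. a * w i)" "norm_of (linf B) = (\<lambda>w. SUP i\<in>B. \<bar>w i\<bar>)"
  by (simp_all add: linf_def)

lemma linf_upper: "w \<in> points (linf B) \<Longrightarrow> i \<in> B \<Longrightarrow> \<bar>w i\<bar> \<le> norm_of (linf B) w"
  by (auto intro!: cSUP_upper bdd_aboveI2)

lemma linf_least: "B \<noteq> {} \<Longrightarrow> (\<And>i. i \<in> B \<Longrightarrow> \<bar>w i\<bar> \<le> c) \<Longrightarrow> norm_of (linf B) w \<le> c"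
  by (auto intro!: cSUP_least)

lemma normed_linf:
  assumes B: "B \<noteq> {}"
  shows "is_normed_space (linf B)"
proof -
  let ?P = "points (linf B)" and ?n = "norm_of (linf B)"
  have plus: "(\<lambda>i. v i + w i) \<in> ?P" if v: "v \<in> ?P" and w: "w \<in> ?P" for v w
  proof -
    have "\<bar>v i + w i\<bar> \<le> ?n v + ?n w" if "i \<in> B" for i
      using linf_upper[OF v that] linf_upper[OF w that] by linarith
    then show ?thesis using v w by auto
  qed
  have scale: "(\<lambda>i. a * w i) \<in> ?P" if w: "w \<in> ?P" for a w
  proof -
    have "\<bar>a * w i\<bar> \<le> \<bar>a\<bar> * ?n w" if "i \<in> B" for i
      using linf_upper[OF w that] by (simp add: abs_mult mult_left_mono)
    then show ?thesis using w by auto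
  qed
  have nn: "0 \<le> ?n w" if "w \<in> ?P" for w
    using B linf_upper[OF that] by (meson abs_ge_zero ex_in_conv order_trans)
  have z: "w = (\<lambda>i. 0)" if "w \<in> ?P" "?n w = 0" for w
  proof
    fix i show "w i = 0" using that linf_upper[OF that(1), of i] by (cases "i \<in> B") auto
  qed
  have z0: "?n (\<lambda>i. 0) = 0" using B by simp
  have tri: "?n (\<lambda>i. v i + w i) \<le> ?n v + ?n w" if v: "v \<in> ?P" and w: "w \<in> ?P" for v w
  proof (rule linf_least[OF B])
    fix i assume "i \<in> B"
    then show "\<bar>v i + w i\<bar> \<le> ?n v + ?n w"
      using linf_upper[OF v, of i] linf_upper[OF w, of i] by linarith
  qed
  have hle: "?n (\<lambda>i. a * w i) \<le> \<bar>a\<bar> * ?n w" if w: "w \<in> ?P" for a w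
  proof (rule linf_least[OF B])
    fix i assume "i \<in> B"
    then show "\<bar>a * w i\<bar> \<le> \<bar>a\<bar> * ?n w"
      using linf_upper[OF w, of i] by (simp add: abs_mult mult_left_mono)
  qed
  have hom: "?n (\<lambda>i. a * w i) = \<bar>a\<bar> * ?n w" if w: "w \<in> ?P" for a w
  proof (cases "a = 0")
    case True
    then show ?thesis using z0 by simp
  next
    case False
    have "?n (\<lambda>i. (1/a) * (a * w i)) \<le> \<bar>1/a\<bar> * ?n (\<lambda>i. a * w i)"
      by (rule hle[OF scale[OF w]])
    moreover have "(\<lambda>i. (1/a) * (a * w i)) = w" using False by simp
    ultimately have "\<bar>a\<bar> * ?n w \<le> ?n (\<lambda>i. a * w i)"
      using False by (simp add: field_simps)
    then show ?thesis using hle[OF w, of a] by simp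
  qed
  have V: "is_vector_space (linf B)"
    unfolding is_vector_space_def linf_simps(2-4)
  proof (intro conjI ballI allI)
    show "(\<lambda>i. 0) \<in> ?P" by auto
  qed (use plus scale in \<open>auto simp: algebra_simps\<close>)
  show ?thesis
    unfolding is_normed_space_def linf_simps(2-4)
    using V nn z z0 tri hom by blast
qed

lemma banach_linf:
  assumes B: "B \<noteq> {}"
  shows "is_banach_space (linf B)"
proof -
  let ?P = "points (linf B)" and ?n = "norm_of (linf B)" and ?d = "dist_of (linf B)"
  note N = normed_linf[OF B]
  interpret M: Metric_space ?P ?d by (rule metric_space_dist_of[OF N])
  have le: "\<bar>v i - w i\<bar> \<le> ?d v w" if "v \<in> ?P" "w \<in> ?P" "i \<in> B" for v w i
  proof -
    have "plus_of (linf B) v (scale_of (linf B) (- 1) w) \<in> ?P"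
      using vs_closed[OF normed_space_laws(1)[OF N]] that by blast
    from linf_upper[OF this \<open>i \<in> B\<close>] that show ?thesis by (simp add: dist_of_def del: linf_simps(1,5))
  qed
  have least: "?d v w \<le> c" if "v \<in> ?P" "w \<in> ?P" "\<And>i. i \<in> B \<Longrightarrow> \<bar>v i - w i\<bar> \<le> c" for v w c
    using that linf_least[OF B, of "plus_of (linf B) v (scale_of (linf B) (- 1) w)" c]
    by (simp add: dist_of_def del: linf_simps(1,5))
  have "\<exists>l. limitin M.mtopology \<sigma> l sequentially" if C: "M.MCauchy \<sigma>" for \<sigma>
  proof -
    have \<sigma>P: "\<sigma> n \<in> ?P" for n using C by (auto simp: M.MCauchy_def simp del: linf_simps)
    have Cau: "\<exists>N. \<forall>n m. N \<le> n \<longrightarrow> N \<le> m \<longrightarrow> ?d (\<sigma> n) (\<sigma> m) < e" if "e > 0" for e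
      using C that by (simp add: M.MCauchy_def)
    have "convergent (\<lambda>n. \<sigma> n i)" if i: "i \<in> B" for i
    proof (rule Cauchy_convergent, rule metric_CauchyI)
      fix e :: real assume "e > 0"
      then obtain N where "\<And>n m. N \<le> n \<Longrightarrow> N \<le> m \<Longrightarrow> ?d (\<sigma> n) (\<sigma> m) < e" using Cau by blast
      then show "\<exists>N. \<forall>m\<ge>N. \<forall>n\<ge>N. dist (\<sigma> m i) (\<sigma> n i) < e"
        using le[OF \<sigma>P \<sigma>P i] unfolding dist_real_def by (meson order_le_less_trans)
    qed
    then obtain l0 where l0: "\<And>i. i \<in> B \<Longrightarrow> (\<lambda>n. \<sigma> n i) \<longlonglongrightarrow> l0 i"
      unfolding convergent_def by metis
    define l where "l = (\<lambda>i. if i \<in> B then l0 i else 0)"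
    have close: "\<bar>\<sigma> n i - l i\<bar> \<le> e"
      if "\<forall>n m. N \<le> n \<longrightarrow> N \<le> m \<longrightarrow> ?d (\<sigma> n) (\<sigma> m) < e" "N \<le> n" "i \<in> B" for N n i e
    proof (rule tendsto_upperbound)
      show "(\<lambda>m. \<bar>\<sigma> n i - \<sigma> m i\<bar>) \<longlonglongrightarrow> \<bar>\<sigma> n i - l i\<bar>"
        using l0[OF that(3)] that(3) unfolding l_def by (auto intro!: tendsto_intros)
      show "\<forall>\<^sub>F m in sequentially. \<bar>\<sigma> n i - \<sigma> m i\<bar> \<le> e"
        unfolding eventually_sequentially
        using le[OF \<sigma>P \<sigma>P that(3)] that by (meson less_imp_le order_trans)
    qed simp
    have lP: "l \<in> ?P"
    proof -
      obtain N where N: "\<forall>n m. N \<le> n \<longrightarrow> N \<le> m \<longrightarrow> ?d (\<sigma> n) (\<sigma> m) < 1" using Cau[of 1] by auto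
      have "\<bar>l i\<bar> \<le> 1 + ?n (\<sigma> N)" if "i \<in> B" for i
        using close[OF N order_refl that] linf_upper[OF \<sigma>P that, of N] by linarith
      then show ?thesis by (auto simp: l_def)
    qed
    have "\<exists>N. \<forall>n\<ge>N. \<sigma> n \<in> ?P \<and> ?d (\<sigma> n) l < e" if "e > 0" for e
    proof -
      obtain N where N: "\<forall>n m. N \<le> n \<longrightarrow> N \<le> m \<longrightarrow> ?d (\<sigma> n) (\<sigma> m) < e/2"
        using Cau[of "e/2"] \<open>e > 0\<close> by auto
      have "?d (\<sigma> n) l \<le> e/2" if "n \<ge> N" for n
        using least[OF \<sigma>P lP] close[OF N that] by blast
      then have "?d (\<sigma> n) l < e" if "n \<ge> N" for n
        using that \<open>e > 0\<close> by (fastforce simp del: linf_simps)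
      then show ?thesis using \<sigma>P by blast
    qed
    then show ?thesis using lP M.limit_metric_sequentially by blast
  qed
  then show ?thesis using N by (simp add: is_banach_space_def M.mcomplete_def)
qed

lemma norming_functional:
  fixes x :: "'x::real_normed_vector"
  shows "\<exists>g. linear g \<and> (\<forall>y. \<bar>g y\<bar> \<le> norm y) \<and> g x = norm x"
proof (cases "x = 0")
  case True
  then show ?thesis by (intro exI[of _ "\<lambda>_. 0"]) (auto simp: linear_iff)
next
  case False
  define \<phi> where "\<phi> = (\<lambda>m. norm x * (SOME c. m = c *\<^sub>R x))"
  have \<phi>: "\<phi> (c *\<^sub>R x) = norm x * c" for c using False by (simp add: \<phi>_def)
  let ?Z = "structure_of TYPE('x)" and ?M = "range (\<lambda>c. c *\<^sub>R x)"
  have M: "is_subspace ?Z ?M"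
    by (auto simp: is_subspace_def image_iff simp flip: scaleR_add_left)
  have "\<exists>g. (\<forall>x\<in>points ?Z. \<forall>y\<in>points ?Z. g (plus_of ?Z x y) = g x + g y) \<and>
             (\<forall>a. \<forall>x\<in>points ?Z. g (scale_of ?Z a x) = a * g x) \<and>
             (\<forall>x\<in>?M. g x = \<phi> x) \<and> (\<forall>x\<in>points ?Z. \<bar>g x\<bar> \<le> 1 * norm_of ?Z x)"
    by (rule hahn_banach_norm[OF normed_structure_of M])
      (auto simp: \<phi> abs_mult algebra_simps simp flip: scaleR_add_left)
  then obtain g where "\<And>a b. g (a + b) = g a + g b" "\<And>a b. g (a *\<^sub>R b) = a * g b"
    "\<And>m. m \<in> ?M \<Longrightarrow> g m = \<phi> m" "\<And>b. \<bar>g b\<bar> \<le> norm b"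
    unfolding structure_of_simps mult_1 by blast
  moreover have "x \<in> ?M" by (metis rangeI scaleR_one)
  ultimately show ?thesis using \<phi>[of 1] by (intro exI[of _ g]) (auto simp: linear_iff)
qed

theorem injective_every_universe:
  assumes inj: "injective_space TYPE('x::banach) lam"
  shows "injective_for TYPE('u) TYPE('x) lam"
  unfolding injective_for_def
proof (intro allI impI, elim conjE)
  fix Z :: "'u normed_structure" and M and T :: "'u \<Rightarrow> 'x"
  assume BZ: "is_banach_space Z" and CM: "is_closed_subspace Z M" and T: "bounded_operator Z M T"
  have Z: "is_normed_space Z" using BZ by (simp add: is_banach_space_def)
  have M: "is_subspace Z M" using CM by (simp add: is_closed_subspace_def)
  note V = normed_space_laws(1)[OF Z]
  have PZ: "is_subspace Z (points Z)" using vs_closed[OF V] by (simp add: is_subspace_def)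
  define t where "t = operator_norm Z M T"
  have t0: "0 \<le> t" and tb: "\<And>x. x \<in> M \<Longrightarrow> norm (T x) \<le> t * norm_of Z x"
    using bounded_operatorD[OF Z M T] by (auto simp: t_def)
  have Tadd: "\<And>x y. x \<in> M \<Longrightarrow> y \<in> M \<Longrightarrow> T (plus_of Z x y) = T x + T y"
    and Tsc: "\<And>a x. x \<in> M \<Longrightarrow> T (scale_of Z a x) = a *\<^sub>R T x"
    using T by (auto simp: bounded_operator_def)
  show "\<exists>S. bounded_operator Z (points Z) S \<and> (\<forall>x\<in>M. S x = T x) \<and>
          operator_norm Z (points Z) S \<le> lam * operator_norm Z M T"
  proof (cases "\<exists>a::'x. a \<noteq> 0")
    case False
    then have 0: "\<And>a::'x. a = 0" by blast
    have 1: "operator_norm Z N S = 0" if "N \<noteq> {}" for N and S :: "'u \<Rightarrow> 'x"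
      using that by (simp add: operator_norm_def 0[of "S _"])
    have "bounded_operator Z (points Z) (\<lambda>_. 0 :: 'x)"
      by (auto simp: bounded_operator_def intro: exI[of _ 0])
    moreover have "M \<noteq> {}" "points Z \<noteq> {}" using M PZ by (auto simp: is_subspace_def)
    ultimately show ?thesis by (metis 0 1 mult_zero_right order_refl)
  next
    case True
    then obtain a0 :: 'x where a0: "a0 \<noteq> 0" by blast
    define B where "B = {\<phi> :: 'x \<Rightarrow> real. linear \<phi> \<and> (\<forall>y. \<bar>\<phi> y\<bar> \<le> norm y)}"
    have "(\<lambda>_. 0) \<in> B" by (auto simp: B_def linear_iff)
    then have B0: "B \<noteq> {}" by blast
    define W where "W = linf B"
    have BW: "is_banach_space W" and NW: "is_normed_space W"
      using banach_linf[OF B0] by (auto simp: W_def is_banach_space_def)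
    note VW = normed_space_laws(1)[OF NW]
    have PW: "is_subspace W (points W)" using vs_closed[OF VW] by (simp add: is_subspace_def)
    define J where "J = (\<lambda>(x::'x) \<phi>. if \<phi> \<in> B then \<phi> x else 0)"
    have JW: "J x \<in> points W" for x by (auto simp: W_def J_def B_def)
    have Jadd: "J (x + y) = plus_of W (J x) (J y)" for x y
      by (auto simp: W_def J_def B_def linear_add)
    have Jsc: "J (c *\<^sub>R x) = scale_of W c (J x)" for c x
      by (auto simp: W_def J_def B_def linear_scale)
    have Jn: "norm_of W (J x) = norm x" for x
    proof (rule antisym)
      show "norm_of W (J x) \<le> norm x"
        unfolding W_def by (rule linf_least[OF B0]) (auto simp: J_def B_def)
      obtain g where "g \<in> B" "g x = norm x" using norming_functional[of x] by (auto simp: B_def)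
      then show "norm x \<le> norm_of W (J x)"
        using linf_upper[OF JW[unfolded W_def], of g x] by (simp add: J_def W_def)
    qed
    have Jd: "dist_of W (J x) (J y) = dist x y" for x y
    proof -
      have "plus_of W (J x) (scale_of W (- 1) (J y)) = J (x - y)"
        using Jadd[of x "(- 1) *\<^sub>R y"] Jsc[of "- 1" y] by simp
      then show ?thesis using JW by (simp add: dist_of_def Jn dist_norm)
    qed
    interpret W: Metric_space "points W" "dist_of W" by (rule metric_space_dist_of[OF NW])
    have Jinj: "inj J" using Jd JW by (metis W.zero dist_eq_0_iff injI)
    have J0: "origin W = J 0" using Jsc[of 0 0] JW by (simp add: scale_zero[OF VW])
    have SJ: "is_subspace W (range J)"
      using JW by (auto simp: is_subspace_def J0 simp flip: Jadd Jsc)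
    have "closedin W.mtopology (range J)"
      unfolding W.metric_closedin_iff_sequentially_closed
    proof (intro conjI allI impI; (elim conjE)?)
      show "range J \<subseteq> points W" using JW by blast
      fix \<sigma> l assume r: "range \<sigma> \<subseteq> range J" and l: "limitin W.mtopology \<sigma> l sequentially"
      have lW: "l \<in> points W" and lim: "\<And>e. e > 0 \<Longrightarrow> \<exists>N. \<forall>n\<ge>N. dist_of W (\<sigma> n) l < e"
        using l unfolding W.limit_metric_sequentially by meson+
      define s where "s = (\<lambda>n. inv J (\<sigma> n))"
      have \<sigma>: "\<sigma> n = J (s n)" for n using r by (auto simp: s_def f_inv_into_f image_subset_iff)
      have "Cauchy s"
      proof (rule metric_CauchyI)
        fix e :: real assume "e > 0"
        then obtain N where N: "\<And>n. n \<ge> N \<Longrightarrow> dist_of W (\<sigma> n) l < e/2"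
          using lim[of "e/2"] by auto
        have "dist (s m) (s n) < e" if "m \<ge> N" "n \<ge> N" for m n
          using W.triangle'[OF JW lW JW, of "s m" "s n"] N[OF that(1)] N[OF that(2)]
          by (simp add: \<sigma> Jd)
        then show "\<exists>N. \<forall>m\<ge>N. \<forall>n\<ge>N. dist (s m) (s n) < e" by blast
      qed
      then obtain x where x: "s \<longlonglongrightarrow> x" using Cauchy_convergent convergent_def by blast
      have "limitin W.mtopology \<sigma> (J x) sequentially"
        unfolding W.limit_metric_sequentially using x JW by (simp add: \<sigma> Jd lim_sequentially)
      then have "l = J x" using l W.limitin_metric_unique by (metis trivial_limit_sequentially)
      then show "l \<in> range J" by blast
    qed
    then have CJ: "is_closed_subspace W (range J)" using SJ by (simp add: is_closed_subspace_def)
    have iJ: "inv J (J x) = x" for x using Jinj by simp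
    have TJ: "bounded_operator W (range J) (inv J)"
      by (auto simp: bounded_operator_def iJ Jn simp flip: Jadd Jsc intro!: exI[of _ 1])
    define k where "k = operator_norm W (range J) (inv J)"
    have "k \<le> 1" unfolding k_def
      by (rule operator_norm_le[OF NW SJ]) (auto simp: iJ Jn)
    moreover have "norm (inv J (J a0)) \<le> k * norm_of W (J a0)"
      unfolding k_def by (rule bounded_operatorD(2)[OF NW SJ TJ]) auto
    ultimately have k1: "k = 1" using a0 by (simp add: iJ Jn)
    obtain P where P: "bounded_operator W (points W) P" "\<And>x. P (J x) = x"
      and Pn: "operator_norm W (points W) P \<le> lam"
      using inj[unfolded injective_space_def injective_for_def, rule_format, of W "range J" "inv J"]
        BW CJ TJ k1 by (auto simp: iJ k_def)
    define q where "q = operator_norm W (points W) P"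
    have q0: "0 \<le> q" and qb: "\<And>w. w \<in> points W \<Longrightarrow> norm (P w) \<le> q * norm_of W w"
      using bounded_operatorD[OF NW PW P(1)] by (auto simp: q_def)
    define Q where "Q = (\<lambda>\<phi> g. (\<forall>x\<in>points Z. \<forall>y\<in>points Z. g (plus_of Z x y) = g x + g y) \<and>
             (\<forall>a. \<forall>x\<in>points Z. g (scale_of Z a x) = a * g x) \<and>
             (\<forall>x\<in>M. g x = (\<phi> \<circ> T) x) \<and> (\<forall>x\<in>points Z. \<bar>g x\<bar> \<le> t * norm_of Z x))"
    have "\<exists>g. Q \<phi> g" if "\<phi> \<in> B" for \<phi>
      unfolding Q_def
    proof (rule hahn_banach_norm[OF Z M t0])
      have lin: "linear \<phi>" and b: "\<And>y. \<bar>\<phi> y\<bar> \<le> norm y" using that by (auto simp: B_def)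
      show "(\<phi> \<circ> T) (plus_of Z x y) = (\<phi> \<circ> T) x + (\<phi> \<circ> T) y" if "x \<in> M" "y \<in> M" for x y
        using that by (simp add: Tadd linear_add[OF lin])
      show "(\<phi> \<circ> T) (scale_of Z a x) = a * (\<phi> \<circ> T) x" if "x \<in> M" for a x
        using that by (simp add: Tsc linear_scale[OF lin])
      show "\<bar>(\<phi> \<circ> T) x\<bar> \<le> t * norm_of Z x" if "x \<in> M" for x
        using b[of "T x"] tb[OF that] by simp
    qed
    then obtain g where "\<And>\<phi>. \<phi> \<in> B \<Longrightarrow> Q \<phi> (g \<phi>)" by metis
    then have g: "\<And>\<phi> x y. \<phi> \<in> B \<Longrightarrow> x \<in> points Z \<Longrightarrow> y \<in> points Z \<Longrightarrow>
          g \<phi> (plus_of Z x y) = g \<phi> x + g \<phi> y"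
        "\<And>\<phi> a x. \<phi> \<in> B \<Longrightarrow> x \<in> points Z \<Longrightarrow> g \<phi> (scale_of Z a x) = a * g \<phi> x"
        "\<And>\<phi> x. \<phi> \<in> B \<Longrightarrow> x \<in> M \<Longrightarrow> g \<phi> x = \<phi> (T x)"
        "\<And>\<phi> x. \<phi> \<in> B \<Longrightarrow> x \<in> points Z \<Longrightarrow> \<bar>g \<phi> x\<bar> \<le> t * norm_of Z x"
      unfolding Q_def comp_def by simp_all
    define G where "G = (\<lambda>z \<phi>. if \<phi> \<in> B then g \<phi> z else 0)"
    have GW: "G z \<in> points W" if "z \<in> points Z" for z
      using g(4)[OF _ that] by (auto simp: W_def G_def)
    have Gn: "norm_of W (G z) \<le> t * norm_of Z z" if "z \<in> points Z" for z
      unfolding W_def by (rule linf_least[OF B0]) (use g(4)[OF _ that] in \<open>auto simp: G_def\<close>)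
    have Gadd: "G (plus_of Z x y) = plus_of W (G x) (G y)" if "x \<in> points Z" "y \<in> points Z" for x y
      using g(1)[OF _ that] by (auto simp: G_def W_def)
    have Gsc: "G (scale_of Z a x) = scale_of W a (G x)" if "x \<in> points Z" for a x
      using g(2)[OF _ that] by (auto simp: G_def W_def)
    have GJ: "G x = J (T x)" if "x \<in> M" for x
      using g(3)[OF _ that] by (auto simp: G_def J_def)
    have Sb: "norm (P (G z)) \<le> q * t * norm_of Z z" if "z \<in> points Z" for z
      using qb[OF GW[OF that]] mult_left_mono[OF Gn[OF that] q0] by (simp add: mult.assoc)
    have "bounded_operator Z (points Z) (\<lambda>z. P (G z))"
      using P(1) GW Sb unfolding bounded_operator_def by (auto simp: Gadd Gsc)
    moreover have "operator_norm Z (points Z) (\<lambda>z. P (G z)) \<le> q * t"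
      using Sb q0 t0 by (intro operator_norm_le[OF Z PZ]) auto
    moreover have "q * t \<le> lam * t" using Pn t0 by (simp add: q_def mult_right_mono)
    ultimately show ?thesis using GJ P(2)
      by (intro exI[of _ "\<lambda>z. P (G z)"]) (auto simp: t_def)
  qed
qed

end

theory Submission
  imports Defs
begin

text \<open>
  If \<open>z\<close> is a multiple of a point \<open>w\<close> at which the norm is smooth, with derivative \<open>g\<close>, then
  \<open>norm (z + v) - norm z\<close> and \<open>norm z - norm (z - v)\<close> both tend to \<open>g v\<close> as the multiple grows.
  An \<open>\<epsilon>\<close>-isometry \<open>f\<close> nearly preserves the distances among \<open>z\<close>, \<open>- z\<close>, \<open>v\<close> and \<open>0\<close>, so a
  functional \<open>\<phi>\<close> that norms \<open>f z - f (- z)\<close> has \<open>\<phi> (f v)\<close> within \<open>3 * \<epsilon>\<close> of \<open>g v\<close>, up to a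
  vanishing error (\<open>norming_functional_far_points\<close>).

  Points that are smooth in finitely many directions up to a tolerance lie arbitrarily close to any
  given point. Taking \<open>w\<close> close to a linear combination of \<open>x\<^sub>1, \<dots>, x\<^sub>n\<close>, and these as the
  directions, turns the estimate for functionals into one for norms
  (\<open>eps_isometry_norm_combination\<close>):
  \<open>norm (\<Sum>i. a\<^sub>i x\<^sub>i) \<le> norm (\<Sum>i. a\<^sub>i f(x\<^sub>i)) + 3 * \<epsilon> * (\<Sum>i. \<bar>a\<^sub>i\<bar>)\<close>.
  No compactness or separability enters, since by the Hahn--Banach theorem this family of finite
  inequalities is exactly what is required for each \<open>g\<close> in the dual ball of the domain to have a
  \<open>\<phi>\<close> in the dual ball of the target with \<open>\<bar>\<phi> (f x) - g x\<bar> \<le> 3 * \<epsilon>\<close> for all \<open>x\<close>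
  (\<open>functional_along_eps_isometry\<close>).

  Choosing such a \<open>\<phi>\<close> for every \<open>g\<close> gives an operator \<open>G\<close> of norm at most \<open>1\<close> from the target
  into the bounded functions on the dual ball of the domain, and \<open>G (f x)\<close> is within
  \<open>3 * \<epsilon>\<close> of the canonical image \<open>J x\<close>. Injectivity supplies a left inverse \<open>P\<close> of \<open>J\<close> of
  norm at most \<open>lam\<close>, and \<open>T = P \<circ> G\<close> satisfies \<open>norm (T (f x) - x) \<le> 3 * lam * \<epsilon>\<close>.
\<close>

section \<open>Almost smooth points of a norm\<close>

text \<open>
  Second differences bounded below by \<open>\<delta> * t\<close> would make the slopes over consecutive steps of
  length \<open>t\<close> grow by \<open>\<delta>\<close> each time, and after enough steps they would leave the interval
  from \<open>- L\<close> to \<open>L\<close>.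
\<close>

lemma lipschitz_small_second_difference:
  fixes h :: "real \<Rightarrow> real"
  assumes lip: "\<And>a b. \<bar>h a - h b\<bar> \<le> L * \<bar>a - b\<bar>" and "\<delta> > 0" "\<rho> > 0"
  shows "\<exists>s t. 0 \<le> s \<and> s < \<rho> \<and> 0 < t \<and> h (s + t) + h (s - t) - 2 * h s < \<delta> * t"
proof (rule ccontr)
  assume "\<not> ?thesis"
  then have big: "\<delta> * t \<le> h (s + t) + h (s - t) - 2 * h s" if "0 \<le> s" "s < \<rho>" "0 < t" for s t
    using that by (meson not_le)
  obtain N :: nat where N: "2 * L < real N * \<delta>"
    using reals_Archimedean3[OF \<open>\<delta> > 0\<close>] by blast
  define t where "t = \<rho> / (real N + 1)"
  have t: "0 < t" "real N * t < \<rho>" using \<open>\<rho> > 0\<close> by (auto simp: t_def field_simps)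
  define D where "D = (\<lambda>j::nat. h (real j * t) - h (real j * t - t))"
  have D: "\<bar>D j\<bar> \<le> L * t" for j using lip[of "real j * t" "real j * t - t"] t by (simp add: D_def)
  have "D 0 + real j * (\<delta> * t) \<le> D j" if "j \<le> N" for j
    using that
  proof (induction j)
    case (Suc j)
    have "real j * t \<le> real N * t" using Suc.prems t by simp
    then have "real j * t < \<rho>" using t(2) by linarith
    then have "\<delta> * t \<le> h (real j * t + t) + h (real j * t - t) - 2 * h (real j * t)"
      using t by (intro big) auto
    moreover have "real (Suc j) * t = real j * t + t" by (simp add: algebra_simps)
    ultimately have "D j + \<delta> * t \<le> D (Suc j)" unfolding D_def by simp
    then show ?case using Suc by (simp add: algebra_simps)
  qed simp
  from this[of N] have "real N * (\<delta> * t) \<le> 2 * L * t" using D[of 0] D[of N] by simp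
  then show False using N t by (simp add: mult.assoc[symmetric])
qed

text \<open>
  For all \<open>\<delta> > 0\<close> together, membership says that the norm is differentiable at \<open>w\<close> in the
  direction \<open>v\<close>: by convexity the second difference quotient shrinks as \<open>t\<close> does, so one step
  controls all smaller ones. Fixing \<open>\<delta>\<close> makes the set open, and then density survives finite
  intersections.
\<close>

definition almost_smooth :: "real \<Rightarrow> 'x::real_normed_vector \<Rightarrow> 'x set" where
  "almost_smooth \<delta> v = {w. \<exists>t>0. norm (w + t *\<^sub>R v) + norm (w - t *\<^sub>R v) - 2 * norm w < \<delta> * t}"

lemma open_almost_smooth: "open (almost_smooth \<delta> v)"
proof -
  have "almost_smooth \<delta> v =
      (\<Union>t\<in>{0<..}. {w. norm (w + t *\<^sub>R v) + norm (w - t *\<^sub>R v) - 2 * norm w < \<delta> * t})"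
    by (auto simp: almost_smooth_def)
  then show ?thesis by (auto intro!: open_UN open_Collect_less continuous_intros)
qed

lemma almost_smooth_dense:
  assumes "\<delta> > 0" "open W" "W \<noteq> {}"
  shows "W \<inter> almost_smooth \<delta> v \<noteq> {}"
proof -
  obtain u e where u: "e > 0" "ball u e \<subseteq> W"
    using assms by (metis all_not_in_conv openE)
  define \<rho> where "\<rho> = e / (norm v + 1)"
  have "0 < norm v + 1" by (simp add: add_nonneg_pos)
  then have \<rho>: "\<rho> > 0" "\<rho> * norm v < e"
    using u(1) by (simp_all add: \<rho>_def pos_divide_less_eq)
  have "\<bar>norm (u + a *\<^sub>R v) - norm (u + b *\<^sub>R v)\<bar> \<le> norm v * \<bar>a - b\<bar>" for a b
    using norm_triangle_ineq3[of "u + a *\<^sub>R v" "u + b *\<^sub>R v"]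
    by (simp add: mult.commute flip: scaleR_left_diff_distrib)
  from lipschitz_small_second_difference[OF this \<open>\<delta> > 0\<close> \<rho>(1)] obtain s t
    where st: "0 \<le> s" "s < \<rho>" "0 < t"
      "norm (u + (s + t) *\<^sub>R v) + norm (u + (s - t) *\<^sub>R v) - 2 * norm (u + s *\<^sub>R v) < \<delta> * t"
    by blast
  have "s * norm v \<le> \<rho> * norm v" using st by (simp add: mult_right_mono)
  then have "u + s *\<^sub>R v \<in> W" using u(2) \<rho>(2) st(1) by (auto simp: dist_norm subset_iff)
  moreover have "u + s *\<^sub>R v \<in> almost_smooth \<delta> v"
    unfolding almost_smooth_def using st(3,4) by (auto simp: algebra_simps)
  ultimately show ?thesis by blast
qed

lemma almost_smooth_dense_finite:
  assumes "finite V" "\<delta> > 0" "open W" "W \<noteq> {}"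
  shows "W \<inter> (\<Inter>v\<in>V. almost_smooth \<delta> v) \<noteq> {}"
  using assms(1,3,4)
proof (induction V arbitrary: W)
  case (insert v V)
  have "(W \<inter> almost_smooth \<delta> v) \<inter> (\<Inter>v\<in>V. almost_smooth \<delta> v) \<noteq> {}"
    by (intro insert.IH open_Int open_almost_smooth almost_smooth_dense insert.prems \<open>\<delta> > 0\<close>)
  then show ?case by (simp add: Int_assoc)
qed simp

text \<open>
  For \<open>r \<ge> 1 / t\<close>, the vector \<open>r w + v\<close> is a combination of \<open>w\<close> and \<open>w + t v\<close> with the
  nonnegative coefficients \<open>r - 1 / t\<close> and \<open>1 / t\<close>. The triangle inequality therefore carries the bound
  at step \<open>t\<close> to the whole ray beyond \<open>w / t\<close>.
\<close>

lemma almost_smooth_ray: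
  assumes "w \<in> almost_smooth \<delta> v"
  shows "\<forall>\<^sub>F r in at_top. norm (r *\<^sub>R w + v) + norm (r *\<^sub>R w - v) \<le> 2 * norm (r *\<^sub>R w) + \<delta>"
proof -
  obtain t where t: "t > 0" "norm (w + t *\<^sub>R v) + norm (w - t *\<^sub>R v) - 2 * norm w < \<delta> * t"
    using assms by (auto simp: almost_smooth_def)
  have "norm (r *\<^sub>R w + v) + norm (r *\<^sub>R w - v) \<le> 2 * norm (r *\<^sub>R w) + \<delta>" if r: "r \<ge> 1/t" for r
  proof -
    have r0: "r \<ge> 0" using r t(1) by (meson divide_nonneg_pos order_trans zero_le_one)
    have *: "norm (r *\<^sub>R w + z) \<le> (r - 1/t) * norm w + (1/t) * norm (w + t *\<^sub>R z)" for z
    proof -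
      have "r *\<^sub>R w + z = (r - 1/t) *\<^sub>R w + (1/t) *\<^sub>R (w + t *\<^sub>R z)"
        using t(1) by (simp add: algebra_simps)
      then have "norm (r *\<^sub>R w + z) \<le> norm ((r - 1/t) *\<^sub>R w) + norm ((1/t) *\<^sub>R (w + t *\<^sub>R z))"
        by (metis norm_triangle_ineq)
      then show ?thesis using r t(1) by simp
    qed
    have "(1/t) * (norm (w + t *\<^sub>R v) + norm (w - t *\<^sub>R v)) \<le> (1/t) * (2 * norm w + \<delta> * t)"
      using t by (intro mult_left_mono) auto
    also have "\<dots> = 2 * (1/t) * norm w + \<delta>" using t(1) by (simp add: field_simps)
    finally have "(1/t) * norm (w + t *\<^sub>R v) + (1/t) * norm (w - t *\<^sub>R v) \<le> 2 * (1/t) * norm w + \<delta>"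
      by (simp add: distrib_left)
    then show ?thesis using *[of v] *[of "- v"] r0 by (simp add: left_diff_distrib)
  qed
  then show ?thesis by (auto simp: eventually_at_top_linorder)
qed

section \<open>The finite weak stability estimate\<close>

text \<open>
  The images of \<open>z\<close> and \<open>- z\<close> are almost \<open>2 * norm z\<close> apart but each almost within \<open>norm z\<close>
  of \<open>f 0 = 0\<close>, so \<open>\<phi> \<circ> f\<close> is close to \<open>norm z\<close> and \<open>- norm z\<close> there. The distances
  of \<open>v\<close> to \<open>z\<close> and \<open>- z\<close> then confine \<open>\<phi> (f v)\<close> from both sides, and smoothness says that the
  two bounds nearly agree with \<open>g v\<close>. Of the \<open>3 * \<epsilon>\<close>, two come from the values at \<open>z\<close> and \<open>- z\<close>
  and one from the distance to \<open>v\<close>.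
\<close>

lemma norming_functional_far_points:
  assumes f: "eps_isometry \<epsilon> f" and f0: "standard_map f"
    and g: "linear g" "\<And>y. \<bar>g y\<bar> \<le> norm y" "g z = norm z"
    and \<phi>: "linear \<phi>" "\<And>y. \<bar>\<phi> y\<bar> \<le> norm y" "\<phi> (f z - f (- z)) = norm (f z - f (- z))"
    and smooth: "norm (z + v) + norm (z - v) \<le> 2 * norm z + \<delta>"
  shows "\<bar>\<phi> (f v) - g v\<bar> \<le> 3 * \<epsilon> + \<delta>"
proof -
  have iso: "norm (f x - f y) \<le> norm (x - y) + \<epsilon>" "norm (x - y) \<le> norm (f x - f y) + \<epsilon>" for x y
    using f unfolding eps_isometry_def by (smt (verit))+
  have \<phi>d: "\<phi> (f x) - \<phi> (f y) \<le> norm (x - y) + \<epsilon>" for x y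
    using \<phi>(2)[of "f x - f y"] iso(1)[of x y] linear_diff[OF \<phi>(1), of "f x" "f y"] by linarith
  have "f 0 = 0" using f0 by (simp add: standard_map_def)
  then have \<phi>0: "\<phi> (f 0) = 0" using linear_0[OF \<phi>(1)] by simp
  have "norm (z - - z) = 2 * norm z"
    by (metis diff_minus_eq_add norm_scaleR scaleR_2 abs_numeral)
  then have far: "2 * norm z - \<epsilon> \<le> \<phi> (f z) - \<phi> (f (- z))"
    using iso(2)[of z "- z"] \<phi>(3) linear_diff[OF \<phi>(1), of "f z" "f (- z)"] by linarith
  have "norm z - 2 * \<epsilon> \<le> \<phi> (f z)" "\<phi> (f (- z)) \<le> 2 * \<epsilon> - norm z"
    using far \<phi>d[of z 0] \<phi>d[of 0 "- z"] \<phi>0 by auto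
  moreover have "norm z + g v \<le> norm (z + v)" "norm z - g v \<le> norm (z - v)"
    using g(2)[of "z + v"] g(2)[of "z - v"] g(3) linear_add[OF g(1)] linear_diff[OF g(1)]
    by (smt (verit))+
  moreover have "\<phi> (f z) - \<phi> (f v) \<le> norm (z - v) + \<epsilon>" "\<phi> (f v) - \<phi> (f (- z)) \<le> norm (z + v) + \<epsilon>"
    using \<phi>d[of z v] \<phi>d[of v "- z"] by (simp_all add: add.commute)
  ultimately show ?thesis using smooth by linarith
qed

text \<open>
  A support functional at an almost smooth point \<open>w\<close> near the combination \<open>u\<close> almost attains
  \<open>norm u\<close>, and its values at the vectors of the combination are almost those of \<open>\<phi> \<circ> f\<close>.
\<close>

lemma eps_isometry_norm_combination:
  assumes f: "eps_isometry \<epsilon> f" and f0: "standard_map f"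
  shows "norm (\<Sum>(a, x)\<leftarrow>l. a *\<^sub>R x) \<le>
           norm (\<Sum>(a, x)\<leftarrow>l. a *\<^sub>R f x) + 3 * \<epsilon> * (\<Sum>(a, x)\<leftarrow>l. \<bar>a\<bar>)"
proof -
  define u where "u = (\<Sum>(a, x)\<leftarrow>l. a *\<^sub>R x)"
  define y where "y = (\<Sum>(a, x)\<leftarrow>l. a *\<^sub>R f x)"
  define A where "A = (\<Sum>(a, x)\<leftarrow>l. \<bar>a\<bar>)"
  have approx: "norm u \<le> norm y + (3 * \<epsilon> + \<delta>) * A + 2 * \<delta>" if "\<delta> > 0" for \<delta>
  proof -
    have "ball u \<delta> \<inter> (\<Inter>v\<in>snd ` set l. almost_smooth \<delta> v) \<noteq> {}"
      using that by (intro almost_smooth_dense_finite) auto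
    then obtain w where w: "norm (u - w) < \<delta>" "\<And>v. v \<in> snd ` set l \<Longrightarrow> w \<in> almost_smooth \<delta> v"
      unfolding ball_def dist_norm by blast
    have "\<forall>\<^sub>F r in at_top. \<forall>v\<in>snd ` set l.
        norm (r *\<^sub>R w + v) + norm (r *\<^sub>R w - v) \<le> 2 * norm (r *\<^sub>R w) + \<delta>"
      using w(2) almost_smooth_ray by (intro eventually_ball_finite ballI) auto
    then have "\<forall>\<^sub>F r in at_top. 0 \<le> r \<and> (\<forall>v\<in>snd ` set l.
        norm (r *\<^sub>R w + v) + norm (r *\<^sub>R w - v) \<le> 2 * norm (r *\<^sub>R w) + \<delta>)"
      by (intro eventually_conj eventually_ge_at_top)
    then obtain r where r: "0 \<le> r" and rw: "\<And>v. v \<in> snd ` set l \<Longrightarrow>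
        norm (r *\<^sub>R w + v) + norm (r *\<^sub>R w - v) \<le> 2 * norm (r *\<^sub>R w) + \<delta>"
      using eventually_happens'[OF trivial_limit_at_top_linorder] by blast
    define z where "z = r *\<^sub>R w"
    obtain g where g: "linear g" "\<And>y. \<bar>g y\<bar> \<le> norm y" "g w = norm w"
      using norming_functional by blast
    have gz: "g z = norm z" using r g by (simp add: z_def linear_scale)
    obtain \<phi> where \<phi>: "linear \<phi>" "\<And>y. \<bar>\<phi> y\<bar> \<le> norm y" "\<phi> (f z - f (- z)) = norm (f z - f (- z))"
      using norming_functional by blast
    have close: "\<bar>\<phi> (f v) - g v\<bar> \<le> 3 * \<epsilon> + \<delta>" if "v \<in> snd ` set l" for v
      by (rule norming_functional_far_points[OF f f0 g(1,2) gz \<phi>])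
        (use rw[OF that] in \<open>auto simp: z_def\<close>)
    \<comment> \<open>Induction over a sublist \<open>k\<close>, because \<open>close\<close> holds only for the vectors of \<open>l\<close>.\<close>
    have "g (\<Sum>(a, x)\<leftarrow>k. a *\<^sub>R x) \<le>
        \<phi> (\<Sum>(a, x)\<leftarrow>k. a *\<^sub>R f x) + (3 * \<epsilon> + \<delta>) * (\<Sum>(a, x)\<leftarrow>k. \<bar>a\<bar>)" if "set k \<subseteq> set l" for k
      using that
    proof (induction k)
      case Nil
      then show ?case using g(1) \<phi>(1) by (simp add: linear_0)
    next
      case (Cons ax k)
      obtain a x where ax: "ax = (a, x)" by force
      have "\<bar>\<phi> (f x) - g x\<bar> \<le> 3 * \<epsilon> + \<delta>" using Cons.prems ax by (intro close) force
      then have "\<bar>a\<bar> * \<bar>\<phi> (f x) - g x\<bar> \<le> \<bar>a\<bar> * (3 * \<epsilon> + \<delta>)" by (rule mult_left_mono) simp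
      then have "a * g x \<le> a * \<phi> (f x) + (3 * \<epsilon> + \<delta>) * \<bar>a\<bar>"
        by (simp add: abs_mult[symmetric] algebra_simps)
      then show ?case using Cons g(1) \<phi>(1)
        by (simp add: ax linear_add linear_scale algebra_simps)
    qed
    from this[of l] have "g u \<le> \<phi> y + (3 * \<epsilon> + \<delta>) * A" by (simp add: u_def y_def A_def)
    moreover have "\<phi> y \<le> norm y" using \<phi>(2)[of y] by linarith
    moreover have "norm w - norm (u - w) \<le> g u"
      using g(2)[of "u - w"] g(3) linear_diff[OF g(1), of u w] by linarith
    moreover have "norm u \<le> norm w + norm (u - w)" by (metis norm_triangle_sub)
    ultimately show ?thesis using w(1) by linarith
  qed
  have "((\<lambda>\<delta>. norm y + (3 * \<epsilon> + \<delta>) * A + 2 * \<delta>) \<longlongrightarrow> norm y + (3 * \<epsilon> + 0) * A + 2 * 0) (at_right 0)"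
    by (intro tendsto_intros)
  moreover have "\<forall>\<^sub>F \<delta> in at_right 0. norm u \<le> norm y + (3 * \<epsilon> + \<delta>) * A + 2 * \<delta>"
    using eventually_at_right_less by (rule eventually_mono) (rule approx)
  ultimately have "norm u \<le> norm y + (3 * \<epsilon> + 0) * A + 2 * 0"
    by (rule tendsto_lowerbound) simp
  then show ?thesis by (simp add: u_def y_def A_def)
qed

section \<open>Functionals along an almost isometry\<close>

text \<open>
  The functional is one below the infimum \<open>p\<close> of
  \<open>norm (y - \<Sum>i. a\<^sub>i F(i)) + (\<Sum>i. a\<^sub>i \<beta>(i)) + c * (\<Sum>i. \<bar>a\<^sub>i\<bar>)\<close> over all finite families. This is
  the largest sublinear function with \<open>p y \<le> norm y\<close>, \<open>p (F i) \<le> \<beta> i + c\<close> and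
  \<open>p (- F i) \<le> c - \<beta> i\<close>, which are the bounds wanted for \<open>\<phi>\<close>; the hypothesis keeps the
  infimum finite. Finite families are lists, since appending them realises addition and repetitions
  do no harm.
\<close>

lemma functional_near_prescribed_values:
  fixes F :: "'i \<Rightarrow> 'y::real_normed_vector"
  assumes bd: "\<And>l. (\<Sum>(a, i)\<leftarrow>l. a * \<beta> i) \<le>
                  norm (\<Sum>(a, i)\<leftarrow>l. a *\<^sub>R F i) + c * (\<Sum>(a, i)\<leftarrow>l. \<bar>a\<bar>)"
  shows "\<exists>\<phi>. linear \<phi> \<and> (\<forall>y. \<bar>\<phi> y\<bar> \<le> norm y) \<and> (\<forall>i. \<bar>\<phi> (F i) - \<beta> i\<bar> \<le> c)"
proof -
  let ?Y = "structure_of TYPE('y)"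
  have V: "is_vector_space ?Y" by (rule normed_space_laws(1)[OF normed_structure_of])
  define h where "h = (\<lambda>l y. norm (y - (\<Sum>(a, i)\<leftarrow>l. a *\<^sub>R F i)) + (\<Sum>(a, i)\<leftarrow>l. a * \<beta> i)
                          + c * (\<Sum>(a, i)\<leftarrow>l. \<bar>a\<bar>))"
  define p where "p = (\<lambda>y. INF l. h l y)"
  have sums_scaled: "(\<Sum>(a, i)\<leftarrow>map (\<lambda>(a, i). (s * a, i)) l. a * \<beta> i) = s * (\<Sum>(a, i)\<leftarrow>l. a * \<beta> i)"
    "(\<Sum>(a, i)\<leftarrow>map (\<lambda>(a, i). (s * a, i)) l. a *\<^sub>R F i) = s *\<^sub>R (\<Sum>(a, i)\<leftarrow>l. a *\<^sub>R F i)"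
    "(\<Sum>(a, i)\<leftarrow>map (\<lambda>(a, i). (s * a, i)) l. \<bar>a\<bar>) = \<bar>s\<bar> * (\<Sum>(a, i)\<leftarrow>l. \<bar>a\<bar>)" for s l
    by (induction l) (auto simp: algebra_simps abs_mult)
  have low: "- norm y \<le> h l y" for l y
  proof -
    have "- (\<Sum>(a, i)\<leftarrow>l. a * \<beta> i) \<le> norm (\<Sum>(a, i)\<leftarrow>l. a *\<^sub>R F i) + c * (\<Sum>(a, i)\<leftarrow>l. \<bar>a\<bar>)"
      using bd[of "map (\<lambda>(a, i). (- 1 * a, i)) l"] unfolding sums_scaled by simp
    then show ?thesis
      using norm_triangle_ineq2[of "\<Sum>(a, i)\<leftarrow>l. a *\<^sub>R F i" y]
      unfolding h_def by (simp add: norm_minus_commute)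
  qed
  have bdd: "bdd_below (range (\<lambda>l. h l y))" for y by (rule bdd_belowI2) (rule low)
  have ph: "p y \<le> h l y" for l y unfolding p_def by (rule cINF_lower[OF bdd]) simp
  have "sublin ?Y (\<lambda>x. if x \<in> points ?Y then INF l\<in>UNIV. h l x else 0)"
  proof (rule sublin_INF[OF V])
    fix k l x y
    have "h (k @ l) (x + y) \<le> h k x + h l y"
      using norm_triangle_ineq[of "x - (\<Sum>(a, i)\<leftarrow>k. a *\<^sub>R F i)" "y - (\<Sum>(a, i)\<leftarrow>l. a *\<^sub>R F i)"]
      by (simp add: h_def algebra_simps)
    then show "\<exists>m\<in>UNIV. h m (plus_of ?Y x y) \<le> h k x + h l y" by auto
  next
    fix l :: "(real \<times> 'i) list" and s :: real and x :: 'y assume "s > 0"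
    have "norm (s *\<^sub>R x - s *\<^sub>R q) = s * norm (x - q)" for q
      using \<open>s > 0\<close> by (simp flip: scaleR_right_diff_distrib)
    then have "h (map (\<lambda>(a, i). (s * a, i)) l) (s *\<^sub>R x) = s * h l x"
      using \<open>s > 0\<close> unfolding h_def sums_scaled by (simp add: algebra_simps)
    then show "\<exists>m\<in>UNIV. h m (scale_of ?Y s x) \<le> s * h l x"
      by (metis UNIV_I order_refl structure_of_simps(4))
  next
    show "\<exists>m\<in>UNIV. h m (origin ?Y) \<le> 0" by (intro bexI[of _ "[]"]) (auto simp: h_def)
  qed (use bdd in auto)
  then have "sublin ?Y p" by (simp add: p_def)
  from hahn_banach_sublin[OF V this] obtain \<phi>
    where lin: "\<And>x y. \<phi> (x + y) = \<phi> x + \<phi> y" "\<And>a x. \<phi> (a *\<^sub>R x) = a * \<phi> x" and le: "\<And>y. \<phi> y \<le> p y"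
    by auto
  have "linear \<phi>" by (rule linearI) (auto simp: lin)
  have neg: "\<phi> (- y) = - \<phi> y" for y using lin(2)[of "- 1" y] by simp
  have \<phi>h: "\<phi> y \<le> h l y" for l y using le ph order_trans by blast
  have "\<phi> y \<le> norm y" for y using \<phi>h[of y "[]"] by (simp add: h_def)
  then have "\<bar>\<phi> y\<bar> \<le> norm y" for y by (metis abs_le_iff neg norm_minus_cancel)
  moreover have "\<bar>\<phi> (F i) - \<beta> i\<bar> \<le> c" for i
    using \<phi>h[of "F i" "[(1, i)]"] \<phi>h[of "- F i" "[(- 1, i)]"] neg[of "F i"] by (simp add: h_def)
  ultimately show ?thesis using \<open>linear \<phi>\<close> by blast
qed

lemma functional_along_eps_isometry:
  assumes "eps_isometry \<epsilon> f" "standard_map f" and g: "linear g" "\<And>y. \<bar>g y\<bar> \<le> norm y"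
  shows "\<exists>\<phi>. linear \<phi> \<and> (\<forall>y. \<bar>\<phi> y\<bar> \<le> norm y) \<and> (\<forall>x. \<bar>\<phi> (f x) - g x\<bar> \<le> 3 * \<epsilon>)"
proof (rule functional_near_prescribed_values)
  fix l
  have "(\<Sum>(a, x)\<leftarrow>l. a * g x) = g (\<Sum>(a, x)\<leftarrow>l. a *\<^sub>R x)"
    by (induction l) (use g(1) in \<open>auto simp: linear_0 linear_add linear_scale\<close>)
  also have "\<dots> \<le> norm (\<Sum>(a, x)\<leftarrow>l. a *\<^sub>R x)" using g(2) abs_le_D1 by blast
  also note eps_isometry_norm_combination[OF assms(1,2)]
  finally show "(\<Sum>(a, x)\<leftarrow>l. a * g x) \<le>
      norm (\<Sum>(a, x)\<leftarrow>l. a *\<^sub>R f x) + 3 * \<epsilon> * (\<Sum>(a, x)\<leftarrow>l. \<bar>a\<bar>)" .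
qed

section \<open>The operator\<close>

text \<open>
  The image of an isometric embedding of a complete space is closed, so the inverse of \<open>J\<close>, an
  operator of norm at most \<open>1\<close> on that image, extends to all of \<open>W\<close>.
\<close>

lemma injective_left_inverse:
  fixes J :: "'x::banach \<Rightarrow> 'u"
  assumes inj: "injective_space TYPE('x) lam" and "0 \<le> lam" and BW: "is_banach_space W"
    and JW: "\<And>x. J x \<in> points W"
    and Jadd: "\<And>x y. J (x + y) = plus_of W (J x) (J y)"
    and Jsc: "\<And>a x. J (a *\<^sub>R x) = scale_of W a (J x)"
    and Jn: "\<And>x. norm_of W (J x) = norm x"
  shows "\<exists>P. bounded_operator W (points W) P \<and> (\<forall>x. P (J x) = x) \<and>
             (\<forall>w\<in>points W. norm (P w) \<le> lam * norm_of W w)"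
proof -
  have NW: "is_normed_space W" using BW by (simp add: is_banach_space_def)
  note VW = normed_space_laws(1)[OF NW]
  interpret W: Metric_space "points W" "dist_of W" by (rule metric_space_dist_of[OF NW])
  have Jd: "dist_of W (J x) (J y) = dist x y" for x y
    using Jn[of "x - y"] Jadd[of x "- y"] Jsc[of "- 1" y] JW by (simp add: dist_of_def dist_norm)
  have iJ: "inv J (J x) = x" for x
    by (rule inv_f_f, rule injI) (metis Jd JW W.zero dist_eq_0_iff)
  have J0: "origin W = J 0" using Jsc[of 0 0] JW by (simp add: scale_zero[OF VW])
  have S: "is_subspace W (range J)"
    using JW by (auto simp: is_subspace_def J0 simp flip: Jadd Jsc)
  have SW: "is_subspace W (points W)" using vs_closed[OF VW] by (simp add: is_subspace_def)
  have "closedin W.mtopology (range J)"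
    unfolding W.metric_closedin_iff_sequentially_closed
  proof (intro conjI allI impI; (elim conjE)?)
    show "range J \<subseteq> points W" using JW by blast
    fix \<sigma> l assume "range \<sigma> \<subseteq> range J" and l: "limitin W.mtopology \<sigma> l sequentially"
    then obtain s where \<sigma>: "\<sigma> = (\<lambda>n. J (s n))" by (metis rangeI f_inv_into_f subsetD)
    have "W.MCauchy \<sigma>"
      using l JW by (intro W.convergent_imp_MCauchy) (auto simp: \<sigma>)
    then have "Cauchy s" unfolding W.MCauchy_def Cauchy_def \<sigma> Jd by meson
    then obtain x where "s \<longlonglongrightarrow> x" using Cauchy_convergent convergent_def by blast
    then have "limitin W.mtopology \<sigma> (J x) sequentially"
      unfolding W.limit_metric_sequentially using JW by (simp add: \<sigma> Jd lim_sequentially)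
    then show "l \<in> range J" using l W.limitin_metric_unique trivial_limit_sequentially by blast
  qed
  then have "is_closed_subspace W (range J)" using S by (simp add: is_closed_subspace_def)
  moreover have "bounded_operator W (range J) (inv J)"
    by (auto simp: bounded_operator_def iJ Jn simp flip: Jadd Jsc intro!: exI[of _ 1])
  ultimately obtain P where P: "bounded_operator W (points W) P" "\<And>x. P (J x) = x"
    and Pn: "operator_norm W (points W) P \<le> lam * operator_norm W (range J) (inv J)"
    using injective_every_universe[OF inj, unfolded injective_for_def, rule_format, of W "range J" "inv J"]
      BW by (auto simp: iJ)
  have "operator_norm W (range J) (inv J) \<le> 1"
    by (rule operator_norm_le[OF NW S]) (auto simp: iJ Jn)
  then have "lam * operator_norm W (range J) (inv J) \<le> lam * 1"
    using \<open>0 \<le> lam\<close> by (rule mult_left_mono)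
  then have "operator_norm W (points W) P \<le> lam" using Pn by simp
  then have "norm (P w) \<le> lam * norm_of W w" if "w \<in> points W" for w
    using bounded_operatorD(2)[OF NW SW P(1) that] normed_space_laws(2)[OF NW that]
    by (meson mult_right_mono order_trans)
  then show ?thesis using P by blast
qed

lemma injective_space_stable_map:
  fixes f :: "'x::banach \<Rightarrow> 'y::banach"
  assumes inj: "injective_space TYPE('x) lam" and "0 \<le> lam"
    and f: "eps_isometry \<epsilon> f" "standard_map f"
  shows "stable_map lam (3 * lam) \<epsilon> f"
proof -
  \<comment> \<open>the closed dual ball, and the canonical embedding into the bounded functions on it\<close>
  define B where "B = {g :: 'x \<Rightarrow> real. linear g \<and> (\<forall>y. \<bar>g y\<bar> \<le> norm y)}"
  have "(\<lambda>_. 0) \<in> B" by (auto simp: B_def linear_iff)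
  then have B0: "B \<noteq> {}" by blast
  define W where "W = linf B"
  have BW: "is_banach_space W" using banach_linf[OF B0] by (simp add: W_def)
  define J where "J = (\<lambda>(x::'x) g. if g \<in> B then g x else 0)"
  have JW: "J x \<in> points W" for x by (auto simp: W_def J_def B_def)
  have Jn: "norm_of W (J x) = norm x" for x
  proof (rule antisym)
    show "norm_of W (J x) \<le> norm x"
      unfolding W_def by (rule linf_least[OF B0]) (auto simp: J_def B_def)
    obtain g where "g \<in> B" "g x = norm x" using norming_functional[of x] by (auto simp: B_def)
    then show "norm x \<le> norm_of W (J x)"
      using linf_upper[OF JW[unfolded W_def], of g x] by (simp add: J_def W_def)
  qed
  have Jadd: "J (x + y) = plus_of W (J x) (J y)" for x y
    by (auto simp: W_def J_def B_def linear_add)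
  have Jsc: "J (a *\<^sub>R x) = scale_of W a (J x)" for a x
    by (auto simp: W_def J_def B_def linear_scale)
  obtain P where P: "bounded_operator W (points W) P" "\<And>x. P (J x) = x"
    and Pn: "\<And>w. w \<in> points W \<Longrightarrow> norm (P w) \<le> lam * norm_of W w"
    using injective_left_inverse[where J = J, OF inj \<open>0 \<le> lam\<close> BW JW Jadd Jsc Jn] by blast
  have Padd: "\<And>v w. v \<in> points W \<Longrightarrow> w \<in> points W \<Longrightarrow> P (plus_of W v w) = P v + P w"
    and Psc: "\<And>a w. w \<in> points W \<Longrightarrow> P (scale_of W a w) = a *\<^sub>R P w"
    using P(1) by (auto simp: bounded_operator_def)
  have "\<forall>g\<in>B. \<exists>\<phi>. linear \<phi> \<and> (\<forall>y. \<bar>\<phi> y\<bar> \<le> norm y) \<and> (\<forall>x. \<bar>\<phi> (f x) - g x\<bar> \<le> 3 * \<epsilon>)"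
    using functional_along_eps_isometry[OF f] by (auto simp: B_def)
  then obtain \<Phi> where \<Phi>: "\<And>g. g \<in> B \<Longrightarrow> linear (\<Phi> g)"
      "\<And>g y. g \<in> B \<Longrightarrow> \<bar>\<Phi> g y\<bar> \<le> norm y" "\<And>g x. g \<in> B \<Longrightarrow> \<bar>\<Phi> g (f x) - g x\<bar> \<le> 3 * \<epsilon>"
    by metis
  define G where "G = (\<lambda>y g. if g \<in> B then \<Phi> g y else 0)"
  have GW: "G y \<in> points W" for y using \<Phi>(2) by (auto simp: W_def G_def)
  have Gn: "norm_of W (G y) \<le> norm y" for y
    unfolding W_def by (rule linf_least[OF B0]) (use \<Phi>(2) in \<open>auto simp: G_def\<close>)
  have Gadd: "G (x + y) = plus_of W (G x) (G y)" for x y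
    using \<Phi>(1) by (auto simp: G_def W_def linear_add)
  have Gsc: "G (a *\<^sub>R y) = scale_of W a (G y)" for a y
    using \<Phi>(1) by (auto simp: G_def W_def linear_scale)
  define T where "T = (\<lambda>y. P (G y))"
  let ?Y = "structure_of TYPE('y)"
  have Tn: "norm (T y) \<le> lam * norm y" for y
    using Pn[OF GW, of y] mult_left_mono[OF Gn[of y] \<open>0 \<le> lam\<close>] by (simp add: T_def)
  have "bounded_operator ?Y (L_space f) T"
    using Tn GW by (auto simp: bounded_operator_def T_def Gadd Gsc Padd Psc)
  moreover have "operator_norm ?Y (L_space f) T \<le> lam"
    by (rule operator_norm_le[OF normed_structure_of _ \<open>0 \<le> lam\<close>])
      (use closed_subspace_L_space[of f] Tn in \<open>auto simp: is_closed_subspace_def\<close>)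
  moreover have "norm (T (f x) - x) \<le> 3 * lam * \<epsilon>" for x
  proof -
    let ?d = "plus_of W (G (f x)) (scale_of W (- 1) (J x))"
    have V: "is_vector_space W"
      using BW by (simp add: is_banach_space_def is_normed_space_def)
    have "T (f x) - x = P ?d"
      using GW JW vs_closed(3)[OF V] by (simp add: Padd Psc P(2) T_def)
    moreover have "?d \<in> points W" using GW JW vs_closed[OF V] by blast
    moreover have "norm_of W ?d \<le> 3 * \<epsilon>"
      unfolding W_def by (rule linf_least[OF B0]) (use \<Phi>(3) in \<open>auto simp: G_def J_def\<close>)
    ultimately show ?thesis
      using Pn[of ?d] mult_left_mono[of "norm_of W ?d" "3 * \<epsilon>" lam] \<open>0 \<le> lam\<close> by simp
  qed
  ultimately show ?thesis unfolding stable_map_def by blast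
qed

theorem theorem3p3:
  fixes lam :: real
  assumes "0 < lam"
    and "injective_space TYPE('x::banach) lam"
  shows "stable_pair TYPE('x) TYPE('y::banach) lam (4 * lam)"
  unfolding stable_pair_def
proof (intro allI impI, elim conjE)
  fix \<epsilon> :: real and f :: "'x \<Rightarrow> 'y"
  assume "0 \<le> \<epsilon>" "eps_isometry \<epsilon> f" "standard_map f"
  then have "stable_map lam (3 * lam) \<epsilon> f" using injective_space_stable_map assms by force
  moreover have "3 * lam * \<epsilon> \<le> 4 * lam * \<epsilon>" using \<open>0 \<le> \<epsilon>\<close> assms(1) by (simp add: mult_right_mono)
  ultimately show "stable_map lam (4 * lam) \<epsilon> f"
    unfolding stable_map_def by (meson order_trans)
qed

end
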